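(* Let $M$ be a regular matroid with ground set $E$, and let $\sigma,\sigma^*$ be acyclic signatures of the circuits and of the cocircuits of $M$, respectively. Let $\hat\beta$ be the map which sends a basis $B$ of $M$ to the orientation $\mathcal{O}(B)$ in which each $e\notin B$ is oriented according to its orientation in $\sigma(C(B,e))$ and each $e\in B$ is oriented according to its orientation in $\sigma^*(C^*(B,e))$. Let $\chi$ be the map which sends an orientation $\mathcal{O}$ to its circuit-cocircuit reversal class $[\mathcal{O}]\in\mathcal{G}(M)$. (1) The image of $\hat\beta$ is contained in $\mathcal{X}(M;\sigma,\sigma^* )$, and $\hat\beta$ gives a bijection between the set $B(M)$ of bases of $M$ and $\mathcal{X}(M;\sigma,\sigma^* )$. (2) The map $\chi$ restricted to $\mathcal{X}(M;\sigma,\sigma^* )$ induces a bijection between $\mathcal{X}(M;\sigma,\sigma^* )$ and $\mathcal{G}(M)$.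
   Context: $M$ is represented by a totally unimodular $r\times m$ matrix $A$ of rank $r$ (every square submatrix has determinant in $\{0,\pm1\}$), with columns indexed by $E$. A signed circuit of $M$ is a nonzero vector in $\ker(A)\cap\mathbb{Z}^E$ with all entries in $\{0,\pm1\}$ whose support is a circuit of $M$; a signed cocircuit is a nonzero vector in (row space of $A$) $\cap\,\mathbb{Z}^E$ with all entries in $\{0,\pm1\}$ whose support is a cocircuit of $M$. Each circuit (cocircuit) is the support of exactly two signed circuits (cocircuits), which are negatives of each other. A signature $\sigma$ of the circuits assigns to each circuit $\underline{C}$ a signed circuit $\sigma(\underline{C})$ with support $\underline{C}$; it is acyclic if the only nonnegative reals $a_{\underline{C}}$ with $\sum_{\underline{C}} a_{\underline{C}}\,\sigma(\underline{C})=0$ are all zero. Signatures $\sigma^*$ of the cocircuits and acyclicity are defined analogously. For a basis $B$ and $e\notin B$, $C(B,e)$ is the unique circuit contained in $B\cup\{e\}$; for $e\in B$, $C^*(B,e)$ is the unique cocircuit contained in $(E\setminus B)\cup\{e\}$. An orientation of $M$ is a function $\mathcal{O}:E\to\{-1,1\}$; orienting $e$ according to a signed (co)circuit $C$ with $e$ in its support means setting $\mathcal{O}(e)=C(e)$. An orientation $\mathcal{O}$ is compatible with a signed circuit or cocircuit $C$ if $\mathcal{O}(e)=C(e)$ for all $e$ in the support of $C$; in that case the reversal along $C$ negates $\mathcal{O}$ on the support of $C$ and leaves it unchanged elsewhere. $\mathcal{G}(M)$ is the set of classes of orientations under the equivalence relation generated by all circuit and cocircuit reversals. $\mathcal{O}$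 is $\sigma$-compatible if every signed circuit compatible with $\mathcal{O}$ is of the form $\sigma(\underline{C})$, and $\sigma^*$-compatible if every signed cocircuit compatible with $\mathcal{O}$ is of the form $\sigma^*(\underline{C})$. $\mathcal{X}(M;\sigma,\sigma^* )$ is the set of orientations that are both $\sigma$-compatible and $\sigma^*$-compatible (called $(\sigma,\sigma^* )$-compatible). *)

theory Defs
  imports "Jordan_Normal_Form.DL_Rank"
begin

section \<open>Matroids given by their independent sets\<close>

definition bases :: "'e set set \<Rightarrow> 'e set set" where
  "bases M = {B \<in> M. \<forall>S \<in> M. B \<subseteq> S \<longrightarrow> S = B}"

definition circuits :: "'e set \<Rightarrow> 'e set set \<Rightarrow> 'e set set" where
  "circuits E M = {C. C \<subseteq> E \<and> C \<notin> M \<and> (\<forall>D. D \<subset> C \<longrightarrow> D \<in> M)}"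

definition dual_matroid :: "'e set \<Rightarrow> 'e set set \<Rightarrow> 'e set set" where
  "dual_matroid E M = {S. S \<subseteq> E \<and> (\<exists>B \<in> bases M. S \<inter> B = {})}"

definition cocircuits :: "'e set \<Rightarrow> 'e set set \<Rightarrow> 'e set set" where
  "cocircuits E M = circuits E (dual_matroid E M)"

definition fund_circuit :: "'e set \<Rightarrow> 'e set set \<Rightarrow> 'e set \<Rightarrow> 'e \<Rightarrow> 'e set" where
  "fund_circuit E M B e = (THE C. C \<in> circuits E M \<and> C \<subseteq> insert e B)"

definition fund_cocircuit :: "'e set \<Rightarrow> 'e set set \<Rightarrow> 'e set \<Rightarrow> 'e \<Rightarrow> 'e set" where
  "fund_cocircuit E M B e = (THE C. C \<in> cocircuits E M \<and> C \<subseteq> insert e (E - B))"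

section \<open>Totally unimodular matrices with columns indexed by a finite set\<close>

text \<open>
  A real matrix with \<open>r\<close> rows and columns indexed by \<open>E\<close> is a function \<open>A\<close>, of which only the
  entries \<open>A i e\<close> with \<open>i < r\<close> and \<open>e \<in> E\<close> matter. Listing row and column indices
  yields an ordinary matrix. Since \<open>E\<close> carries no order, the columns (and rows) of a submatrix may
  be listed in any order; this affects a determinant only by its sign, and the rank not at all.
\<close>

definition listed_submatrix :: "(nat \<Rightarrow> 'e \<Rightarrow> real) \<Rightarrow> nat list \<Rightarrow> 'e list \<Rightarrow> real mat" where
  "listed_submatrix A rs es = mat (length rs) (length es) (\<lambda>(i, j). A (rs ! i) (es ! j))"

definition totally_unimodular :: "nat \<Rightarrow> 'e set \<Rightarrow> (nat \<Rightarrow> 'e \<Rightarrow> real) \<Rightarrow> bool" where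
  "totally_unimodular r E A \<longleftrightarrow>
     (\<forall>rs es. distinct rs \<and> set rs \<subseteq> {..<r} \<and> distinct es \<and> set es \<subseteq> E \<and> length rs = length es
        \<longrightarrow> det (listed_submatrix A rs es) \<in> {-1, 0, 1})"

definition has_rank :: "nat \<Rightarrow> 'e set \<Rightarrow> (nat \<Rightarrow> 'e \<Rightarrow> real) \<Rightarrow> nat \<Rightarrow> bool" where
  "has_rank r E A k \<longleftrightarrow>
     (\<forall>es. distinct es \<and> set es = E \<longrightarrow> vec_space.rank r (listed_submatrix A [0..<r] es) = k)"

text \<open>
  The matroid represented by \<open>A\<close>. Independence is that of the family of columns, so that
  equal columns with different indices are dependent.
\<close>

definition column_matroid :: "nat \<Rightarrow> 'e set \<Rightarrow> (nat \<Rightarrow> 'e \<Rightarrow> real) \<Rightarrow> 'e set set" where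
  "column_matroid r E A = {S. S \<subseteq> E \<and>
     (\<forall>c :: 'e \<Rightarrow> real. (\<forall>i<r. (\<Sum>e\<in>S. c e * A i e) = 0) \<longrightarrow> (\<forall>e\<in>S. c e = 0))}"

section \<open>Signed circuits and cocircuits\<close>

text \<open>Elements of \<open>\<int>\<^sup>E\<close> are integer-valued functions that vanish outside \<open>E\<close>.\<close>

definition supp :: "('e \<Rightarrow> int) \<Rightarrow> 'e set" where
  "supp x = {e. x e \<noteq> 0}"

definition sign_vectors :: "'e set \<Rightarrow> ('e \<Rightarrow> int) set" where
  "sign_vectors E = {x. (\<forall>e\<in>E. x e \<in> {-1, 0, 1}) \<and> (\<forall>e. e \<notin> E \<longrightarrow> x e = 0)}"

definition in_kernel :: "nat \<Rightarrow> 'e set \<Rightarrow> (nat \<Rightarrow> 'e \<Rightarrow> real) \<Rightarrow> ('e \<Rightarrow> int) \<Rightarrow> bool" where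
  "in_kernel r E A x \<longleftrightarrow> (\<forall>i<r. (\<Sum>e\<in>E. A i e * of_int (x e)) = 0)"

definition in_row_space :: "nat \<Rightarrow> 'e set \<Rightarrow> (nat \<Rightarrow> 'e \<Rightarrow> real) \<Rightarrow> ('e \<Rightarrow> int) \<Rightarrow> bool" where
  "in_row_space r E A x \<longleftrightarrow>
     (\<exists>y :: nat \<Rightarrow> real. \<forall>e\<in>E. of_int (x e) = (\<Sum>i<r. y i * A i e))"

definition signed_circuits :: "nat \<Rightarrow> 'e set \<Rightarrow> (nat \<Rightarrow> 'e \<Rightarrow> real) \<Rightarrow> ('e \<Rightarrow> int) set" where
  "signed_circuits r E A =
     {x \<in> sign_vectors E. supp x \<noteq> {} \<and> in_kernel r E A x \<and>
        supp x \<in> circuits E (column_matroid r E A)}"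

definition signed_cocircuits :: "nat \<Rightarrow> 'e set \<Rightarrow> (nat \<Rightarrow> 'e \<Rightarrow> real) \<Rightarrow> ('e \<Rightarrow> int) set" where
  "signed_cocircuits r E A =
     {x \<in> sign_vectors E. supp x \<noteq> {} \<and> in_row_space r E A x \<and>
        supp x \<in> cocircuits E (column_matroid r E A)}"

section \<open>Signatures\<close>

text \<open>
  \<open>\<C>\<close> is the set of all circuits or of all cocircuits, and \<open>\<S>\<close> the set of the
  corresponding signed objects.
\<close>

definition signature :: "'e set set \<Rightarrow> ('e \<Rightarrow> int) set \<Rightarrow> ('e set \<Rightarrow> 'e \<Rightarrow> int) \<Rightarrow> bool" where
  "signature \<C> \<S> \<sigma> \<longleftrightarrow> (\<forall>C\<in>\<C>. \<sigma> C \<in> \<S> \<and> supp (\<sigma> C) = C)"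

definition acyclic_signature :: "'e set \<Rightarrow> 'e set set \<Rightarrow> ('e set \<Rightarrow> 'e \<Rightarrow> int) \<Rightarrow> bool" where
  "acyclic_signature E \<C> \<sigma> \<longleftrightarrow>
     (\<forall>a :: 'e set \<Rightarrow> real.
        (\<forall>C\<in>\<C>. 0 \<le> a C) \<and> (\<forall>e\<in>E. (\<Sum>C\<in>\<C>. a C * of_int (\<sigma> C e)) = 0)
          \<longrightarrow> (\<forall>C\<in>\<C>. a C = 0))"

section \<open>Orientations\<close>

definition orientations :: "'e set \<Rightarrow> ('e \<Rightarrow> int) set" where
  "orientations E = E \<rightarrow>\<^sub>E {-1, 1}"

definition compatible :: "('e \<Rightarrow> int) \<Rightarrow> ('e \<Rightarrow> int) \<Rightarrow> bool" where
  "compatible \<O> x \<longleftrightarrow> (\<forall>e \<in> supp x. \<O> e = x e)"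

definition reversal :: "('e \<Rightarrow> int) \<Rightarrow> ('e \<Rightarrow> int) \<Rightarrow> 'e \<Rightarrow> int" where
  "reversal \<O> x = (\<lambda>e. if e \<in> supp x then - \<O> e else \<O> e)"

definition reversal_step ::
    "nat \<Rightarrow> 'e set \<Rightarrow> (nat \<Rightarrow> 'e \<Rightarrow> real) \<Rightarrow> ('e \<Rightarrow> int) \<Rightarrow> ('e \<Rightarrow> int) \<Rightarrow> bool" where
  "reversal_step r E A \<O> \<O>' \<longleftrightarrow> \<O> \<in> orientations E \<and>
     (\<exists>x \<in> signed_circuits r E A \<union> signed_cocircuits r E A.
        compatible \<O> x \<and> \<O>' = reversal \<O> x)"

definition reversal_equiv ::
    "nat \<Rightarrow> 'e set \<Rightarrow> (nat \<Rightarrow> 'e \<Rightarrow> real) \<Rightarrow> (('e \<Rightarrow> int) \<times> ('e \<Rightarrow> int)) set" where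
  "reversal_equiv r E A =
     {(\<O>, \<O>') \<in> orientations E \<times> orientations E. equivclp (reversal_step r E A) \<O> \<O>'}"

definition reversal_classes ::
    "nat \<Rightarrow> 'e set \<Rightarrow> (nat \<Rightarrow> 'e \<Rightarrow> real) \<Rightarrow> ('e \<Rightarrow> int) set set" where
  "reversal_classes r E A = orientations E // reversal_equiv r E A"

definition reversal_class ::
    "nat \<Rightarrow> 'e set \<Rightarrow> (nat \<Rightarrow> 'e \<Rightarrow> real) \<Rightarrow> ('e \<Rightarrow> int) \<Rightarrow> ('e \<Rightarrow> int) set" where
  "reversal_class r E A \<O> = reversal_equiv r E A `` {\<O>}"

definition sig_compatible ::
    "'e set set \<Rightarrow> ('e \<Rightarrow> int) set \<Rightarrow> ('e set \<Rightarrow> 'e \<Rightarrow> int) \<Rightarrow> ('e \<Rightarrow> int) \<Rightarrow> bool" where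
  "sig_compatible \<C> \<S> \<sigma> \<O> \<longleftrightarrow> (\<forall>x\<in>\<S>. compatible \<O> x \<longrightarrow> (\<exists>C\<in>\<C>. x = \<sigma> C))"

definition compatible_orientations ::
    "nat \<Rightarrow> 'e set \<Rightarrow> (nat \<Rightarrow> 'e \<Rightarrow> real) \<Rightarrow> ('e set \<Rightarrow> 'e \<Rightarrow> int) \<Rightarrow> ('e set \<Rightarrow> 'e \<Rightarrow> int)
      \<Rightarrow> ('e \<Rightarrow> int) set" where
  "compatible_orientations r E A \<sigma> \<sigma>s = {\<O> \<in> orientations E.
     sig_compatible (circuits E (column_matroid r E A)) (signed_circuits r E A) \<sigma> \<O> \<and>
     sig_compatible (cocircuits E (column_matroid r E A)) (signed_cocircuits r E A) \<sigma>s \<O>}"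

definition basis_orientation ::
    "'e set \<Rightarrow> 'e set set \<Rightarrow> ('e set \<Rightarrow> 'e \<Rightarrow> int) \<Rightarrow> ('e set \<Rightarrow> 'e \<Rightarrow> int) \<Rightarrow> 'e set
      \<Rightarrow> 'e \<Rightarrow> int" where
  "basis_orientation E M \<sigma> \<sigma>s B = restrict
     (\<lambda>e. if e \<in> B then \<sigma>s (fund_cocircuit E M B e) e else \<sigma> (fund_circuit E M B e) e) E"

end

theory Submission
  imports Defs
begin

text \<open>
  Let \<open>K\<close> be the kernel and \<open>R\<close> the row space of \<open>A\<close>. They are orthogonal complements in
  \<open>\<real>\<^sup>E\<close>, the circuits are the minimal supports of nonzero vectors of \<open>K\<close>, the cocircuits those
  of \<open>R\<close>, and \<open>B\<close> is a basis iff \<open>B\<close> contains no support from \<open>K\<close> and \<open>E - B\<close> none from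
  \<open>R\<close> (\<open>bases_iff\<close>, \<open>dual_matroid_eq\<close>). This picture does not change when \<open>K\<close> and
  \<open>R\<close> are exchanged, so everything about a single signature is proved once, for an arbitrary
  orthogonal pair, and applied to circuits and to cocircuits.

  By Farkas' lemma, acyclicity of \<open>\<sigma>\<close> yields a weight \<open>w \<in> K\<close> with \<open>w \<bullet> \<sigma>(C) > 0\<close> for all
  circuits \<open>C\<close>, and acyclicity of \<open>\<sigma>s\<close> a weight \<open>ws \<in> R\<close> (\<open>acyclic_signature_weight\<close>). A
  circuit reversal that \<open>\<sigma>\<close> forbids is then recognised by its effect on \<open>w\<close>.

  The first part is linear programming. For a basis \<open>B\<close> there are vectors \<open>x \<in> ws + K\<close>
  supported in \<open>B\<close> and \<open>z \<in> w + R\<close> supported in \<open>E - B\<close>, and pairing them with the fundamental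
  signed cocircuits and circuits shows that their signs are exactly the orientation \<open>\<O>(B)\<close>
  (\<open>reduced_weights_exist\<close>). So if all elements are reoriented such that \<open>\<O>(B)\<close> becomes
  positive, \<open>x\<close> is a basic solution and \<open>z\<close> the vector of reduced costs of the program
  of minimising \<open>w \<bullet> x\<close> over the nonnegative \<open>x \<in> ws + K\<close>, and both are nondegenerate.
  A nondegenerate optimal basis is unique, which is injectivity
  (\<open>basis_subset_if_same_orientation\<close>). Conversely, for a compatible orientation, compatibility
  with \<open>\<sigma>s\<close> makes this program feasible and compatibility with \<open>\<sigma>\<close> makes its dual feasible, so
  there is a complementary pair of solutions (\<open>complementary_solutions\<close>). Since \<open>w\<close> and
  \<open>ws\<close> are nonzero on every signed circuit and cocircuit, the pair is nondegenerate
  and comes from a basis (\<open>compatible_orientation_from_basis\<close>).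

  For the second part, every class contains a compatible orientation because reversing a
  forbidden circuit or cocircuit increases \<open>(w + ws) \<bullet> \<O>\<close>, so a maximiser in the class
  has none (\<open>incompatible_orientation_reversal\<close>). It contains only one: equivalent
  orientations differ by \<open>2 (k + y)\<close> with integer vectors \<open>k \<in> K\<close> and \<open>y \<in> R\<close>. Where
  \<open>k + y\<close> is nonzero it agrees with \<open>\<O>\<close>, so by integrality \<open>k(e) y(e) \<le> 0\<close> for
  all \<open>e\<close>; as \<open>k \<bullet> y = 0\<close>, the supports of \<open>k\<close> and \<open>y\<close> are disjoint. A circuit conformal to
  \<open>k\<close> would then be compatible with one orientation and its negative with the other,
  although only one of the two is \<open>\<sigma>(C)\<close> (\<open>compatible_orientations_congruent_eq\<close>).
\<close>

section \<open>Linear functionals and Farkas' lemma\<close>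

text \<open>
  The vectors are seen only through the functionals, so \<open>W\<close> needs to be closed under linear
  combinations only as far as these can tell, and its type carries no vector space structure.
  The proof is Bartl's induction on the number of functionals. If \<open>\<alpha> m\<close> is indispensable, there
  is a point \<open>p\<close> with \<open>\<gamma> p < 0\<close> at which \<open>\<alpha> m\<close> is the only negative one; replacing the other
  functionals by their compositions with the projection along \<open>p\<close> onto the kernel of
  \<open>\<alpha> m\<close> removes \<open>\<alpha> m\<close> from the system.
\<close>

lemma farkas_functionals:
  fixes \<alpha> :: "'i \<Rightarrow> 'v \<Rightarrow> real" and \<gamma> :: "'v \<Rightarrow> real"
  assumes "finite I"
    and "\<And>x y c. x \<in> W \<Longrightarrow> y \<in> W \<Longrightarrow>
           \<exists>z\<in>W. (\<forall>i\<in>I. \<alpha> i z = \<alpha> i x + c * \<alpha> i y) \<and> \<gamma> z = \<gamma> x + c * \<gamma> y"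
    and "\<And>x. x \<in> W \<Longrightarrow> \<forall>i\<in>I. 0 \<le> \<alpha> i x \<Longrightarrow> 0 \<le> \<gamma> x"
  shows "\<exists>l. (\<forall>i\<in>I. 0 \<le> l i) \<and> (\<forall>x\<in>W. \<gamma> x = (\<Sum>i\<in>I. l i * \<alpha> i x))"
  using assms
proof (induction I arbitrary: \<alpha> \<gamma> rule: finite_induct)
  case empty
  have "\<gamma> x = 0" if x: "x \<in> W" for x
  proof -
    obtain z where "z \<in> W" "\<gamma> z = \<gamma> x + (-2) * \<gamma> x"
      using empty.prems(1)[OF x x, of "-2"] by blast
    then show ?thesis
      using empty.prems(2)[of z] empty.prems(2)[of x] x by simp
  qed
  then show ?case by simp
next
  case (insert m I)
  show ?case
  proof (cases "\<forall>x\<in>W. (\<forall>i\<in>I. 0 \<le> \<alpha> i x) \<longrightarrow> 0 \<le> \<gamma> x")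
    case True
    have "\<exists>l. (\<forall>i\<in>I. 0 \<le> l i) \<and> (\<forall>x\<in>W. \<gamma> x = (\<Sum>i\<in>I. l i * \<alpha> i x))"
    proof (rule insert.IH)
      fix x y c assume "x \<in> W" "y \<in> W"
      then show "\<exists>z\<in>W. (\<forall>i\<in>I. \<alpha> i z = \<alpha> i x + c * \<alpha> i y) \<and> \<gamma> z = \<gamma> x + c * \<gamma> y"
        using insert.prems(1)[of x y c] by blast
    qed (use True in blast)
    then obtain l where l: "\<forall>i\<in>I. 0 \<le> l i" "\<forall>x\<in>W. \<gamma> x = (\<Sum>i\<in>I. l i * \<alpha> i x)"
      by blast
    have "(\<Sum>i\<in>insert m I. (l(m := 0)) i * \<alpha> i x) = (\<Sum>i\<in>I. l i * \<alpha> i x)" for x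
    proof -
      have "(\<Sum>i\<in>I. (l(m := 0)) i * \<alpha> i x) = (\<Sum>i\<in>I. l i * \<alpha> i x)"
        using insert.hyps by (intro sum.cong) auto
      then show ?thesis using insert.hyps by simp
    qed
    then show ?thesis
      using l by (intro exI[of _ "l(m := 0)"]) auto
  next
    case False
    then obtain p where p: "p \<in> W" "\<forall>i\<in>I. 0 \<le> \<alpha> i p" "\<gamma> p < 0"
      by force
    define s where "s = \<alpha> m p"
    have s: "s < 0"
      using insert.prems(2)[OF p(1)] p(2,3) by (force simp: s_def)
    define \<alpha>' where "\<alpha>' i x = \<alpha> i x - \<alpha> i p / s * \<alpha> m x" for i x
    define \<gamma>' where "\<gamma>' x = \<gamma> x - \<gamma> p / s * \<alpha> m x" for x
    have "\<exists>l. (\<forall>i\<in>I. 0 \<le> l i) \<and> (\<forall>x\<in>W. \<gamma>' x = (\<Sum>i\<in>I. l i * \<alpha>' i x))"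
    proof (rule insert.IH)
      fix x y c assume "x \<in> W" "y \<in> W"
      then obtain z where "z \<in> W" "\<forall>i\<in>insert m I. \<alpha> i z = \<alpha> i x + c * \<alpha> i y"
          "\<gamma> z = \<gamma> x + c * \<gamma> y"
        using insert.prems(1)[of x y c] by blast
      then show "\<exists>z\<in>W. (\<forall>i\<in>I. \<alpha>' i z = \<alpha>' i x + c * \<alpha>' i y) \<and> \<gamma>' z = \<gamma>' x + c * \<gamma>' y"
        by (intro bexI[of _ z]) (auto simp: \<alpha>'_def \<gamma>'_def algebra_simps)
    next
      fix x assume x: "x \<in> W" "\<forall>i\<in>I. 0 \<le> \<alpha>' i x"
      obtain z where z: "z \<in> W" "\<forall>i\<in>insert m I. \<alpha> i z = \<alpha> i x + (- \<alpha> m x / s) * \<alpha> i p"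
          "\<gamma> z = \<gamma> x + (- \<alpha> m x / s) * \<gamma> p"
        using insert.prems(1)[OF x(1) p(1)] by blast
      have "\<alpha> m z = 0" using z(2) s by (simp add: s_def)
      moreover have "\<alpha> i z = \<alpha>' i x" if "i \<in> I" for i
        using z(2) that by (simp add: \<alpha>'_def)
      moreover have "\<gamma> z = \<gamma>' x" using z(3) by (simp add: \<gamma>'_def)
      ultimately show "0 \<le> \<gamma>' x" using insert.prems(2)[OF z(1)] x(2) by simp
    qed
    then obtain l where l: "\<forall>i\<in>I. 0 \<le> l i" "\<forall>x\<in>W. \<gamma>' x = (\<Sum>i\<in>I. l i * \<alpha>' i x)"
      by blast
    define c where "c = (\<gamma> p - (\<Sum>i\<in>I. l i * \<alpha> i p)) / s"
    have "0 \<le> (\<Sum>i\<in>I. l i * \<alpha> i p)"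
      using l(1) p(2) by (intro sum_nonneg) auto
    then have c: "0 \<le> c"
      using p(3) s by (simp add: c_def zero_le_divide_iff)
    have "\<gamma> x = (\<Sum>i\<in>insert m I. (l(m := c)) i * \<alpha> i x)" if "x \<in> W" for x
    proof -
      have "(\<Sum>i\<in>I. l i * \<alpha>' i x) =
          (\<Sum>i\<in>I. l i * \<alpha> i x) - (\<Sum>i\<in>I. l i * \<alpha> i p) / s * \<alpha> m x"
        by (simp add: \<alpha>'_def right_diff_distrib sum_subtractf sum_distrib_right
            sum_divide_distrib mult.assoc)
      then have "\<gamma> x = (\<Sum>i\<in>I. l i * \<alpha> i x) + c * \<alpha> m x"
        using l(2) that by (simp add: \<gamma>'_def c_def diff_divide_distrib algebra_simps)
      moreover have "(\<Sum>i\<in>I. (l(m := c)) i * \<alpha> i x) = (\<Sum>i\<in>I. l i * \<alpha> i x)"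
        using insert.hyps by (intro sum.cong) auto
      ultimately show ?thesis using insert.hyps by simp
    qed
    then show ?thesis
      using l(1) c by (intro exI[of _ "l(m := c)"]) auto
  qed
qed

text \<open>
  An equation is a pair of opposite inequalities, so this is Farkas' lemma for the functionals
  \<open>\<alpha> i\<close> and \<open>- \<alpha> i\<close>.
\<close>

lemma functional_in_span_if_kernel_subset:
  fixes \<alpha> :: "'i \<Rightarrow> 'v \<Rightarrow> real" and \<gamma> :: "'v \<Rightarrow> real"
  assumes T: "finite T"
    and lin: "\<And>x y c. x \<in> W \<Longrightarrow> y \<in> W \<Longrightarrow>
           \<exists>z\<in>W. (\<forall>i\<in>T. \<alpha> i z = \<alpha> i x + c * \<alpha> i y) \<and> \<gamma> z = \<gamma> x + c * \<gamma> y"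
    and ker: "\<And>x. x \<in> W \<Longrightarrow> \<forall>i\<in>T. \<alpha> i x = 0 \<Longrightarrow> \<gamma> x = 0"
  shows "\<exists>c. \<forall>x\<in>W. \<gamma> x = (\<Sum>i\<in>T. c i * \<alpha> i x)"
proof -
  define \<beta> where "\<beta> = (\<lambda>(i, b) x. if b then \<alpha> i x else - \<alpha> i x)"
  have "\<exists>l. (\<forall>j\<in>T \<times> UNIV. 0 \<le> l j) \<and> (\<forall>x\<in>W. \<gamma> x = (\<Sum>j\<in>T \<times> UNIV. l j * \<beta> j x))"
  proof (rule farkas_functionals)
    fix x y c assume "x \<in> W" "y \<in> W"
    then obtain z where "z \<in> W" "\<forall>i\<in>T. \<alpha> i z = \<alpha> i x + c * \<alpha> i y" "\<gamma> z = \<gamma> x + c * \<gamma> y"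
      using lin[of x y c] by blast
    then show "\<exists>z\<in>W. (\<forall>j\<in>T \<times> UNIV. \<beta> j z = \<beta> j x + c * \<beta> j y) \<and> \<gamma> z = \<gamma> x + c * \<gamma> y"
      by (intro bexI[of _ z]) (auto simp: \<beta>_def)
  next
    fix x assume x: "x \<in> W" "\<forall>j\<in>T \<times> UNIV. 0 \<le> \<beta> j x"
    have "\<alpha> i x = 0" if "i \<in> T" for i
      using x(2)[rule_format, of "(i, True)"] x(2)[rule_format, of "(i, False)"] that
      by (simp add: \<beta>_def)
    then show "0 \<le> \<gamma> x" using ker[OF x(1)] by simp
  qed (use T in simp)
  then obtain l where l: "\<forall>x\<in>W. \<gamma> x = (\<Sum>j\<in>T \<times> UNIV. l j * \<beta> j x)" by blast
  have "(\<Sum>j\<in>T \<times> UNIV. l j * \<beta> j x) = (\<Sum>i\<in>T. (l (i, True) - l (i, False)) * \<alpha> i x)" for x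
  proof -
    have "(\<Sum>j\<in>T \<times> UNIV. l j * \<beta> j x) = (\<Sum>i\<in>T. \<Sum>b\<in>UNIV. l (i, b) * \<beta> (i, b) x)"
      by (simp add: sum.cartesian_product)
    then show ?thesis by (simp add: UNIV_bool \<beta>_def algebra_simps)
  qed
  then show ?thesis using l by (intro exI[of _ "\<lambda>i. l (i, True) - l (i, False)"]) simp
qed

section \<open>Orthogonal pairs of subspaces\<close>

abbreviation real_vec :: "('e \<Rightarrow> int) \<Rightarrow> 'e \<Rightarrow> real" where
  "real_vec x \<equiv> \<lambda>e. real_of_int (x e)"

definition dot :: "'e set \<Rightarrow> ('e \<Rightarrow> real) \<Rightarrow> ('e \<Rightarrow> real) \<Rightarrow> real" where
  "dot E f g = (\<Sum>e\<in>E. f e * g e)"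

lemma dot_commute: "dot E f g = dot E g f"
  by (simp add: dot_def mult.commute)

lemma dot_linear: "dot E f (\<lambda>e. g e + c * h e) = dot E f g + c * dot E f h"
  by (simp add: dot_def algebra_simps sum.distrib sum_distrib_left)

lemma dot_linear_left: "dot E (\<lambda>e. g e + c * h e) f = dot E g f + c * dot E h f"
  using dot_linear dot_commute by metis

lemma dot_diff: "dot E f (\<lambda>e. g e - h e) = dot E f g - dot E f h"
  by (simp add: dot_def algebra_simps sum_subtractf)

lemma dot_diff_left: "dot E (\<lambda>e. g e - h e) f = dot E g f - dot E h f"
  using dot_diff dot_commute by metis

lemma dot_unit: "finite E \<Longrightarrow> e \<in> E \<Longrightarrow> dot E f (\<lambda>d. if d = e then 1 else 0) = f e"
  by (simp add: dot_def if_distrib cong: if_cong)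

text \<open>
  For the kernel of a matrix this is its column matroid, and for the row space the dual of that
  matroid.
\<close>

definition independent_sets :: "'e set \<Rightarrow> ('e \<Rightarrow> real) set \<Rightarrow> 'e set set" where
  "independent_sets E L = {S. S \<subseteq> E \<and> (\<forall>k\<in>L. (\<forall>e. e \<notin> S \<longrightarrow> k e = 0) \<longrightarrow> (\<forall>e. k e = 0))}"

text \<open>
  For the kernel of a matrix these are the signed circuits, and for the row space the signed
  cocircuits.
\<close>

definition signed_circuits_of :: "'e set \<Rightarrow> ('e \<Rightarrow> real) set \<Rightarrow> ('e \<Rightarrow> int) set" where
  "signed_circuits_of E L = {x \<in> sign_vectors E. supp x \<noteq> {} \<and> real_vec x \<in> L \<and>
     supp x \<in> circuits E (independent_sets E L)}"

lemma independent_sets_mono: "T \<subseteq> S \<Longrightarrow> S \<in> independent_sets E L \<Longrightarrow> T \<in> independent_sets E L"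
  unfolding independent_sets_def by blast

lemma independent_sets_subset: "S \<in> independent_sets E L \<Longrightarrow> S \<subseteq> E"
  by (simp add: independent_sets_def)

text \<open>
  The ratio test: moving from \<open>k\<close> against \<open>h\<close>, stop when the first coordinate vanishes. Until
  then no coordinate has changed its sign.
\<close>

lemma conformal_reduction:
  fixes h k :: "'e \<Rightarrow> real"
  assumes fin: "finite E" and sub: "\<And>e. k e = 0 \<Longrightarrow> h e = 0"
    and e0: "e0 \<in> E" "0 < h e0 * k e0"
  obtains t where "0 < t" "\<And>e. e \<in> E \<Longrightarrow> k e - t * h e \<noteq> 0 \<Longrightarrow> 0 < (k e - t * h e) * k e"
    "\<exists>e\<in>E. k e \<noteq> 0 \<and> k e - t * h e = 0"
proof -
  define P where "P = {e \<in> E. 0 < h e * k e}"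
  have P: "finite P" "P \<noteq> {}" using fin e0 by (auto simp: P_def)
  define t where "t = Min ((\<lambda>e. k e / h e) ` P)"
  have "t \<in> (\<lambda>e. k e / h e) ` P" unfolding t_def using P by (intro Min_in) auto
  then obtain m where m: "m \<in> P" "t = k m / h m" by auto
  have "0 < t" using m by (auto simp: P_def zero_less_mult_iff zero_less_divide_iff)
  moreover have "0 < (k e - t * h e) * k e" if e: "e \<in> E" "k e - t * h e \<noteq> 0" for e
  proof -
    have k: "k e \<noteq> 0" using sub[of e] e(2) by auto
    have "t * (h e * k e) \<le> k e * k e"
    proof (cases "e \<in> P")
      case True
      then have "t \<le> k e / h e" unfolding t_def using P(1) by (intro Min_le) auto
      then have "t * (h e * k e) \<le> k e / h e * (h e * k e)"
        using True by (intro mult_right_mono) (auto simp: P_def)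
      moreover have "h e \<noteq> 0" using True by (auto simp: P_def)
      ultimately show ?thesis by simp
    next
      case False
      then have "t * (h e * k e) \<le> 0"
        using e(1) \<open>0 < t\<close> by (simp add: mult_nonneg_nonpos P_def not_less)
      then show ?thesis using zero_le_square[of "k e"] by linarith
    qed
    then have "0 \<le> (k e - t * h e) * k e" by (simp add: algebra_simps)
    moreover have "(k e - t * h e) * k e \<noteq> 0" using k e by simp
    ultimately show ?thesis by linarith
  qed
  moreover have "\<exists>e\<in>E. k e \<noteq> 0 \<and> k e - t * h e = 0"
    using m by (intro bexI[of _ m]) (auto simp: P_def)
  ultimately show ?thesis using that by blast
qed

text \<open>
  Vectors of \<open>\<real>\<^sup>E\<close> are functions that vanish outside \<open>E\<close>. The two conditions make \<open>K\<close> and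
  \<open>R\<close> each other's orthogonal complement, and hence subspaces.
\<close>

locale orthogonal_pair =
  fixes E :: "'e set" and K R :: "('e \<Rightarrow> real) set"
  assumes finite_E: "finite E"
    and K_iff: "\<And>k. k \<in> K \<longleftrightarrow> (\<forall>e. e \<notin> E \<longrightarrow> k e = 0) \<and> (\<forall>y\<in>R. dot E k y = 0)"
    and R_iff: "\<And>y. y \<in> R \<longleftrightarrow> (\<forall>e. e \<notin> E \<longrightarrow> y e = 0) \<and> (\<forall>k\<in>K. dot E k y = 0)"
begin

lemma dual: "orthogonal_pair E R K"
proof
  show "finite E" by (fact finite_E)
  show "y \<in> R \<longleftrightarrow> (\<forall>e. e \<notin> E \<longrightarrow> y e = 0) \<and> (\<forall>k\<in>K. dot E y k = 0)" for y
    unfolding dot_commute[of E y] by (rule R_iff)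
  show "k \<in> K \<longleftrightarrow> (\<forall>e. e \<notin> E \<longrightarrow> k e = 0) \<and> (\<forall>y\<in>R. dot E y k = 0)" for k
    unfolding dot_commute[of E _ k] by (rule K_iff)
qed

lemma orthogonal: "k \<in> K \<Longrightarrow> y \<in> R \<Longrightarrow> dot E k y = 0"
  using K_iff by blast

lemma dot_cong_orthogonal:
  assumes "(\<lambda>e. f e - g e) \<in> R" "k \<in> K"
  shows "dot E f k = dot E g k"
  using orthogonal[OF assms(2,1)] by (simp add: dot_diff dot_commute[of E k])

lemma outside: "k \<in> K \<Longrightarrow> e \<notin> E \<Longrightarrow> k e = 0"
  using K_iff by blast

lemma combination_in: "k \<in> K \<Longrightarrow> h \<in> K \<Longrightarrow> (\<lambda>e. k e + c * h e) \<in> K"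
  by (simp add: K_iff dot_linear_left)

lemma zero_in: "(\<lambda>_. 0) \<in> K"
  by (simp add: K_iff dot_def)

lemma scale_in: "h \<in> K \<Longrightarrow> (\<lambda>e. c * h e) \<in> K"
  using combination_in[OF zero_in] by simp

lemma diff_in: "k \<in> K \<Longrightarrow> h \<in> K \<Longrightarrow> (\<lambda>e. k e - h e) \<in> K"
  using combination_in[of k h "-1"] by simp

lemma sum_in:
  assumes "finite I" "\<And>i. i \<in> I \<Longrightarrow> h i \<in> K"
  shows "(\<lambda>e. \<Sum>i\<in>I. c i * h i e) \<in> K"
  using assms
proof (induction I rule: finite_induct)
  case (insert i I)
  then have "(\<lambda>e. (\<Sum>i\<in>I. c i * h i e) + c i * h i e) \<in> K" by (intro combination_in) auto
  then show ?case using insert.hyps by (simp add: add.commute)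
qed (simp add: zero_in)

lemma dependent_set_vector:
  assumes "S \<subseteq> E" "S \<notin> independent_sets E K"
  obtains k d where "k \<in> K" "\<And>e. e \<notin> S \<Longrightarrow> k e = 0" "k d \<noteq> 0"
proof -
  have "\<exists>k\<in>K. (\<forall>e. e \<notin> S \<longrightarrow> k e = 0) \<and> (\<exists>d. k d \<noteq> 0)"
    using assms by (simp add: independent_sets_def)
  then obtain k d where k: "k \<in> K" "\<forall>e. e \<notin> S \<longrightarrow> k e = 0" "k d \<noteq> 0" by force
  show ?thesis by (rule that[OF k(1) _ k(3)]) (use k(2) in simp)
qed

lemma independent_not_vanishing:
  assumes "S \<in> independent_sets E K" "k \<in> K" "\<And>e. e \<notin> S \<Longrightarrow> k e = 0"
  shows "k e = 0"
  using assms by (simp add: independent_sets_def)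

text \<open>
  On \<open>R\<close>, a vector that vanishes on \<open>T\<close> vanishes at \<open>e\<close>. So evaluation at \<open>e\<close> is a linear
  combination of the evaluations at \<open>T\<close>, and this relation, being orthogonal to \<open>R\<close>, is the
  vector sought.
\<close>

lemma vector_of_spanning_set:
  assumes T: "T \<subseteq> E" "E - T \<in> independent_sets E R" and e: "e \<in> E - T"
  obtains k where "k \<in> K" "k e = 1" "\<And>d. d \<notin> insert e T \<Longrightarrow> k d = 0"
proof -
  have fin: "finite T" by (rule finite_subset[OF T(1) finite_E])
  have "\<exists>c. \<forall>y\<in>R. y e = (\<Sum>t\<in>T. c t * y t)"
  proof (rule functional_in_span_if_kernel_subset[OF fin])
    fix x y :: "'e \<Rightarrow> real" and c assume xy: "x \<in> R" "y \<in> R"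
    show "\<exists>z\<in>R. (\<forall>t\<in>T. z t = x t + c * y t) \<and> z e = x e + c * y e"
      by (rule bexI[OF _ orthogonal_pair.combination_in[OF dual xy, of c]]) simp
  next
    fix y assume y: "y \<in> R" "\<forall>t\<in>T. y t = 0"
    show "y e = 0"
    proof (rule orthogonal_pair.independent_not_vanishing[OF dual T(2) y(1)])
      show "y d = 0" if "d \<notin> E - T" for d
        using that y(2) orthogonal_pair.outside[OF dual y(1), of d] by blast
    qed
  qed
  then obtain c where c: "\<forall>y\<in>R. y e = (\<Sum>t\<in>T. c t * y t)" by blast
  define k where "k d = (if d = e then 1 else if d \<in> T then - c d else 0)" for d
  have "dot E k y = 0" if "y \<in> R" for y
  proof -
    have "dot E k y = (\<Sum>d\<in>insert e T. k d * y d)"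
      unfolding dot_def using T e finite_E by (intro sum.mono_neutral_right) (auto simp: k_def)
    also have "\<dots> = y e + (\<Sum>d\<in>T. k d * y d)"
      using fin e by (simp add: k_def)
    also have "(\<Sum>d\<in>T. k d * y d) = - (\<Sum>d\<in>T. c d * y d)"
      unfolding sum_negf[symmetric] using e by (intro sum.cong) (auto simp: k_def)
    finally show ?thesis using c that by simp
  qed
  then have "k \<in> K" unfolding K_iff using T e by (auto simp: k_def)
  then show ?thesis using that by (auto simp: k_def)
qed

text \<open>
  The support of a vector of \<open>K\<close> and that of a vector of \<open>R\<close> never meet in exactly one element,
  by orthogonality. Adding to \<open>B\<close> an element of the support of a vector of \<open>R\<close> outside \<open>B\<close> would
  produce such a meeting.
\<close>

lemma complement_of_maximal_independent:
  assumes B: "B \<in> independent_sets E K"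
    and max: "\<And>S. S \<in> independent_sets E K \<Longrightarrow> B \<subseteq> S \<Longrightarrow> S = B"
  shows "E - B \<in> independent_sets E R"
proof -
  have "y e = 0" if y: "y \<in> R" "\<forall>d. d \<notin> E - B \<longrightarrow> y d = 0" for y e
  proof (rule ccontr)
    assume ye: "y e \<noteq> 0"
    then have e: "e \<in> E" "e \<notin> B" using y by auto
    then have "insert e B \<notin> independent_sets E K" using max[of "insert e B"] by auto
    moreover have "insert e B \<subseteq> E" using e B independent_sets_subset by blast
    ultimately obtain k d where k: "k \<in> K" "\<And>d. d \<notin> insert e B \<Longrightarrow> k d = 0" "k d \<noteq> 0"
      using dependent_set_vector[of "insert e B"] by metis
    have "k e \<noteq> 0"
      using k independent_not_vanishing[OF B k(1)] by (metis insertE)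
    have "dot E k y = (\<Sum>d\<in>{e}. k d * y d)"
      unfolding dot_def using finite_E e k y by (intro sum.mono_neutral_right) auto
    then show False using orthogonal[OF k(1) y(1)] \<open>k e \<noteq> 0\<close> ye by simp
  qed
  then show ?thesis unfolding independent_sets_def by blast
qed

lemma bases_iff:
  "B \<in> bases (independent_sets E K) \<longleftrightarrow>
     B \<subseteq> E \<and> B \<in> independent_sets E K \<and> E - B \<in> independent_sets E R"
proof
  assume "B \<in> bases (independent_sets E K)"
  then show "B \<subseteq> E \<and> B \<in> independent_sets E K \<and> E - B \<in> independent_sets E R"
    using complement_of_maximal_independent[of B] independent_sets_subset[of B E K]
    unfolding bases_def by blast
next
  assume B: "B \<subseteq> E \<and> B \<in> independent_sets E K \<and> E - B \<in> independent_sets E R"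
  have "S = B" if S: "S \<in> independent_sets E K" "B \<subseteq> S" for S
  proof (rule ccontr)
    assume "S \<noteq> B"
    then obtain e where e: "e \<in> S" "e \<in> E - B" using S independent_sets_subset by blast
    then obtain k where k: "k \<in> K" "k e = 1" "\<And>d. d \<notin> insert e B \<Longrightarrow> k d = 0"
      using vector_of_spanning_set B by metis
    have "k d = 0" if "d \<notin> S" for d using that e S by (intro k(3)) auto
    then show False using independent_not_vanishing[OF S(1) k(1), of e] k(2) by simp
  qed
  then show "B \<in> bases (independent_sets E K)" using B by (auto simp: bases_def)
qed

lemma dual_matroid_eq: "dual_matroid E (independent_sets E K) = independent_sets E R"
proof (intro equalityI subsetI)
  fix S assume "S \<in> dual_matroid E (independent_sets E K)"
  then obtain B where "S \<subseteq> E" "S \<inter> B = {}" "B \<in> bases (independent_sets E K)"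
    by (auto simp: dual_matroid_def)
  then have "S \<subseteq> E - B" "E - B \<in> independent_sets E R" by (auto simp: bases_iff)
  then show "S \<in> independent_sets E R" using independent_sets_mono by blast
next
  fix S assume S: "S \<in> independent_sets E R"
  have fin: "finite (independent_sets E R)"
    by (rule finite_subset[of _ "Pow E"]) (auto simp: finite_E dest: independent_sets_subset)
  then obtain T where T: "T \<in> independent_sets E R" "S \<subseteq> T"
      "\<forall>U\<in>independent_sets E R. T \<subseteq> U \<longrightarrow> T = U"
    using finite_has_maximal2[OF fin S] by blast
  have "E - T \<in> independent_sets E K"
    by (rule orthogonal_pair.complement_of_maximal_independent[OF dual]) (use T in auto)
  moreover have "T \<subseteq> E" using T independent_sets_subset by blast
  ultimately have "E - T \<in> bases (independent_sets E K)"
    using T(1) unfolding bases_iff by (simp add: double_diff)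
  then show "S \<in> dual_matroid E (independent_sets E K)"
    using T(2) \<open>T \<subseteq> E\<close> unfolding dual_matroid_def by blast
qed

text \<open>
  Eliminating \<open>e\<close> from \<open>k\<close> and \<open>h\<close> gives a vector supported in a proper subset of the circuit.
\<close>

lemma circuit_proportional:
  assumes C: "C \<in> circuits E (independent_sets E K)"
    and k: "k \<in> K" "\<And>e. e \<notin> C \<Longrightarrow> k e = 0" and h: "h \<in> K" "\<And>e. e \<notin> C \<Longrightarrow> h e = 0"
  shows "k d * h e = k e * h d"
proof (cases "e \<in> C")
  case True
  then have "C - {e} \<in> independent_sets E K" using C by (auto simp: circuits_def)
  moreover have "(\<lambda>d. h e * k d + (- k e) * h d) \<in> K"
    by (rule combination_in[OF scale_in[OF k(1)] h(1)])
  ultimately have "h e * k d + (- k e) * h d = 0"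
    by (rule independent_not_vanishing) (use k h in auto)
  then show ?thesis by (simp add: mult.commute)
qed (simp add: k h)

text \<open>
  Among the nonzero vectors of \<open>K\<close> conformal to \<open>k\<close>, one of minimal support works: a vector with
  properly smaller support could be used to shorten it further by the ratio test.
\<close>

lemma conformal_circuit_vector:
  assumes k: "k \<in> K" "k d \<noteq> 0"
  obtains h where "h \<in> K" "\<And>e. h e \<noteq> 0 \<Longrightarrow> 0 < h e * k e"
    "{e. h e \<noteq> 0} \<in> circuits E (independent_sets E K)"
proof -
  define P where "P h \<longleftrightarrow> h \<in> K \<and> (\<exists>e. h e \<noteq> 0) \<and> (\<forall>e. h e \<noteq> 0 \<longrightarrow> 0 < h e * k e)" for h
  have "P k" using k by (auto simp: P_def zero_less_mult_iff)
  then obtain h where h: "P h" "\<And>g. P g \<Longrightarrow> card {e. h e \<noteq> 0} \<le> card {e. g e \<noteq> 0}"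
    using ex_has_least_nat[of P k "\<lambda>h. card {e. h e \<noteq> 0}"] by blast
  have hK: "h \<in> K" using h(1) by (simp add: P_def)
  have sub: "{e. h e \<noteq> 0} \<subseteq> E" using outside[OF hK] by blast
  have "{e. h e \<noteq> 0} \<notin> independent_sets E K"
  proof
    assume "{e. h e \<noteq> 0} \<in> independent_sets E K"
    then have "h e = 0" for e by (rule independent_not_vanishing[OF _ hK]) simp
    then show False using h(1) by (simp add: P_def)
  qed
  moreover have "D \<in> independent_sets E K" if D: "D \<subset> {e. h e \<noteq> 0}" for D
  proof (rule ccontr)
    assume "D \<notin> independent_sets E K"
    moreover have "D \<subseteq> E" using D sub by blast
    ultimately obtain g0 e0 where g0: "g0 \<in> K" "\<And>e. e \<notin> D \<Longrightarrow> g0 e = 0" "g0 e0 \<noteq> 0"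
      using dependent_set_vector[of D] by metis
    define g where "g e = g0 e0 * h e0 * g0 e" for e
    have g: "g \<in> K" "\<And>e. e \<notin> D \<Longrightarrow> g e = 0"
      using g0 scale_in[OF g0(1), of "g0 e0 * h e0"] by (auto simp: g_def[abs_def])
    have e0: "e0 \<in> D" using g0 by blast
    then have "h e0 \<noteq> 0" using D by blast
    have "g e0 * h e0 = (g0 e0 * h e0)\<^sup>2" by (simp add: g_def power2_eq_square)
    then have pos: "0 < g e0 * h e0" using g0(3) \<open>h e0 \<noteq> 0\<close> by simp
    have gh: "\<And>e. h e = 0 \<Longrightarrow> g e = 0" using g(2) D by blast
    obtain t where t: "0 < t" "\<And>e. e \<in> E \<Longrightarrow> h e - t * g e \<noteq> 0 \<Longrightarrow> 0 < (h e - t * g e) * h e"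
        "\<exists>e\<in>E. h e \<noteq> 0 \<and> h e - t * g e = 0"
      by (rule conformal_reduction[where k = h and h = g, OF finite_E gh _ pos]) (use e0 \<open>D \<subseteq> E\<close> in auto)
    define h' where "h' e = h e - t * g e" for e
    have h'K: "h' \<in> K" using combination_in[OF hK g(1), of "- t"] by (simp add: h'_def[abs_def])
    obtain f where f: "h f \<noteq> 0" "f \<notin> D" using D by blast
    have "P h'" unfolding P_def
    proof (intro conjI allI impI)
      show "\<exists>e. h' e \<noteq> 0" using f g by (intro exI[of _ f]) (simp add: h'_def)
      fix e assume e: "h' e \<noteq> 0"
      then have "e \<in> E" using outside[OF h'K] by blast
      then have "0 < h' e * h e" using t(2) e by (simp add: h'_def)
      moreover from this have "h e \<noteq> 0" by auto
      then have "0 < h e * k e" using h(1) by (simp add: P_def)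
      ultimately show "0 < h' e * k e" by (auto simp: zero_less_mult_iff)
    qed (fact h'K)
    moreover have "{e. h' e \<noteq> 0} \<subset> {e. h e \<noteq> 0}"
      using t(3) gh by (force simp: h'_def)
    then have "card {e. h' e \<noteq> 0} < card {e. h e \<noteq> 0}"
      using sub finite_E by (intro psubset_card_mono) (auto intro: finite_subset)
    ultimately show False using h(2)[of h'] by simp
  qed
  ultimately have "{e. h e \<noteq> 0} \<in> circuits E (independent_sets E K)"
    using sub by (auto simp: circuits_def)
  then show ?thesis using that h(1) by (auto simp: P_def)
qed

lemma circuit_in_dependent_set:
  assumes "S \<subseteq> E" "S \<notin> independent_sets E K"
  obtains C where "C \<in> circuits E (independent_sets E K)" "C \<subseteq> S"
proof -
  obtain k d where k: "k \<in> K" "\<And>e. e \<notin> S \<Longrightarrow> k e = 0" "k d \<noteq> 0"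
    using dependent_set_vector[OF assms] by metis
  obtain h where h: "\<And>e. h e \<noteq> 0 \<Longrightarrow> 0 < h e * k e"
      "{e. h e \<noteq> 0} \<in> circuits E (independent_sets E K)"
    using conformal_circuit_vector[OF k(1,3)] by blast
  show ?thesis by (rule that[OF h(2)]) (use h(1) k(2) in force)
qed

lemma circuit_vector:
  assumes "C \<in> circuits E (independent_sets E K)"
  obtains k where "k \<in> K" "\<And>e. k e \<noteq> 0 \<longleftrightarrow> e \<in> C"
proof -
  obtain k d where k: "k \<in> K" "\<And>e. e \<notin> C \<Longrightarrow> k e = 0" "k d \<noteq> 0"
    using assms dependent_set_vector[of C] unfolding circuits_def mem_Collect_eq by metis
  have "k e \<noteq> 0" if "e \<in> C" for e
  proof
    assume "k e = 0"
    moreover have "C - {e} \<in> independent_sets E K" using assms that by (auto simp: circuits_def)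
    ultimately show False using k independent_not_vanishing[of "C - {e}" k d] by auto
  qed
  then show ?thesis using that k by blast
qed

lemma fund_circuit:
  assumes B: "B \<in> bases (independent_sets E K)" and e: "e \<in> E - B"
  shows "fund_circuit E (independent_sets E K) B e \<in> circuits E (independent_sets E K)"
    and "fund_circuit E (independent_sets E K) B e \<subseteq> insert e B"
    and "e \<in> fund_circuit E (independent_sets E K) B e"
proof -
  have BE: "B \<subseteq> E" "B \<in> independent_sets E K" using B by (auto simp: bases_iff)
  have in_C: "e \<in> C" if "C \<in> circuits E (independent_sets E K)" "C \<subseteq> insert e B" for C
  proof (rule ccontr)
    assume "e \<notin> C"
    then have "C \<subseteq> B" using that by blast
    then show False using independent_sets_mono[OF _ BE(2)] that by (auto simp: circuits_def)
  qed
  have "insert e B \<noteq> B" using e by blast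
  then have "insert e B \<notin> independent_sets E K" using B by (auto simp: bases_def)
  moreover have "insert e B \<subseteq> E" using BE e by auto
  ultimately obtain C where C: "C \<in> circuits E (independent_sets E K)" "C \<subseteq> insert e B"
    using circuit_in_dependent_set by metis
  have unique: "D = C" if D: "D \<in> circuits E (independent_sets E K)" "D \<subseteq> insert e B" for D
  proof -
    obtain k where k: "k \<in> K" "\<And>d. k d \<noteq> 0 \<longleftrightarrow> d \<in> C" using circuit_vector[OF C(1)] by blast
    obtain h where h: "h \<in> K" "\<And>d. h d \<noteq> 0 \<longleftrightarrow> d \<in> D" using circuit_vector[OF D(1)] by blast
    have "(\<lambda>d. h e * k d + (- k e) * h d) \<in> K"
    by (rule combination_in[OF scale_in[OF k(1)] h(1)])
    then have "h e * k d + (- k e) * h d = 0" for d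
    proof (rule independent_not_vanishing[OF BE(2)])
      fix d assume "d \<notin> B"
      then show "h e * k d + (- k e) * h d = 0"
        using C(2) D(2) k(2)[of d] h(2)[of d] by (cases "d = e") auto
    qed
    then have eq: "h e * k d = k e * h d" for d by (simp add: algebra_simps)
    moreover have "k e \<noteq> 0" "h e \<noteq> 0" using in_C C D k h by auto
    ultimately have "k d \<noteq> 0 \<longleftrightarrow> h d \<noteq> 0" for d by (metis mult_eq_0_iff)
    then show ?thesis using k h by blast
  qed
  have "fund_circuit E (independent_sets E K) B e = C"
    unfolding fund_circuit_def
  proof (rule the_equality)
    show "D = C" if "D \<in> circuits E (independent_sets E K) \<and> D \<subseteq> insert e B" for D
      using unique that by blast
  qed (simp add: C)
  then show "fund_circuit E (independent_sets E K) B e \<in> circuits E (independent_sets E K)"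
    "fund_circuit E (independent_sets E K) B e \<subseteq> insert e B"
    "e \<in> fund_circuit E (independent_sets E K) B e"
    using C in_C[OF C] by simp_all
qed

text \<open>
  Gordan's alternative. The weight can be taken in \<open>K\<close> itself: a nonnegative combination \<open>u\<close> of
  the vectors \<open>\<sigma>(C)\<close> that is orthogonal to \<open>K\<close> lies in \<open>K\<close>, hence is orthogonal to itself
  and vanishes. That \<open>w\<close> lies in \<open>K\<close> makes it blind to cocircuits.
\<close>

lemma acyclic_signature_weight:
  assumes sig: "signature (circuits E (independent_sets E K)) (signed_circuits_of E K) \<sigma>"
    and acyc: "acyclic_signature E (circuits E (independent_sets E K)) \<sigma>"
  obtains w where "w \<in> K"
    "\<And>C. C \<in> circuits E (independent_sets E K) \<Longrightarrow> 0 < dot E w (real_vec (\<sigma> C))"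
proof -
  let ?\<C> = "circuits E (independent_sets E K)"
  have fin: "finite ?\<C>"
    by (rule finite_subset[of _ "Pow E"]) (auto simp: finite_E circuits_def)
  have in_K: "real_vec (\<sigma> C) \<in> K" if "C \<in> ?\<C>" for C
    using sig that by (auto simp: signature_def signed_circuits_of_def)
  \<comment> \<open>It suffices to be strict on one circuit at a time: the sum of these weights is strict on all.\<close>
  have "\<exists>w\<in>K. (\<forall>C\<in>?\<C>. 0 \<le> dot E w (real_vec (\<sigma> C))) \<and> 0 < dot E w (real_vec (\<sigma> D))"
    if D: "D \<in> ?\<C>" for D
  proof (rule ccontr)
    assume no: "\<not> ?thesis"
    have "\<exists>l. (\<forall>C\<in>?\<C>. 0 \<le> l C) \<and>
        (\<forall>k\<in>K. - dot E k (real_vec (\<sigma> D)) = (\<Sum>C\<in>?\<C>. l C * dot E k (real_vec (\<sigma> C))))"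
    proof (rule farkas_functionals[OF fin])
      fix x y :: "'e \<Rightarrow> real" and c assume xy: "x \<in> K" "y \<in> K"
      show "\<exists>z\<in>K. (\<forall>C\<in>?\<C>. dot E z (real_vec (\<sigma> C)) =
            dot E x (real_vec (\<sigma> C)) + c * dot E y (real_vec (\<sigma> C))) \<and>
          - dot E z (real_vec (\<sigma> D)) = - dot E x (real_vec (\<sigma> D)) + c * - dot E y (real_vec (\<sigma> D))"
        by (rule bexI[OF _ combination_in[OF xy, of c]]) (simp add: dot_linear_left)
    next
      fix k assume "k \<in> K" "\<forall>C\<in>?\<C>. 0 \<le> dot E k (real_vec (\<sigma> C))"
      then have "\<not> 0 < dot E k (real_vec (\<sigma> D))" using no by blast
      then show "0 \<le> - dot E k (real_vec (\<sigma> D))" by simp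
    qed
    then obtain l where l: "\<forall>C\<in>?\<C>. 0 \<le> l C"
      "\<forall>k\<in>K. - dot E k (real_vec (\<sigma> D)) = (\<Sum>C\<in>?\<C>. l C * dot E k (real_vec (\<sigma> C)))" by blast
    define a where "a C = l C + (if C = D then 1 else 0)" for C
    define u where "u e = (\<Sum>C\<in>?\<C>. a C * real_of_int (\<sigma> C e))" for e
    have "u \<in> K" unfolding u_def by (rule sum_in[OF fin in_K])
    have u: "u e = (\<Sum>C\<in>?\<C>. l C * real_of_int (\<sigma> C e)) + 1 * real_of_int (\<sigma> D e)" for e
    proof -
      have "a C * real_of_int (\<sigma> C e) =
          l C * real_of_int (\<sigma> C e) + (if C = D then real_of_int (\<sigma> C e) else 0)" for C
        by (simp add: a_def distrib_right)
      then show ?thesis using D fin by (simp add: u_def sum.distrib)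
    qed
    have "dot E u (\<lambda>e. \<Sum>C\<in>?\<C>. l C * real_of_int (\<sigma> C e)) =
        (\<Sum>C\<in>?\<C>. l C * dot E u (real_vec (\<sigma> C)))"
      unfolding dot_def sum_distrib_left by (subst sum.swap) (simp add: mult_ac)
    then have "dot E u u = 0"
      using l(2)[rule_format, OF \<open>u \<in> K\<close>] dot_linear[of E u _ 1 "real_vec (\<sigma> D)"]
      by (simp add: u[abs_def])
    then have "\<forall>e\<in>E. u e = 0" using finite_E by (simp add: dot_def sum_nonneg_eq_0_iff)
    moreover have "\<forall>C\<in>?\<C>. 0 \<le> a C" using l(1) by (simp add: a_def)
    ultimately have "\<forall>C\<in>?\<C>. a C = 0" using acyc unfolding acyclic_signature_def u_def by blast
    then show False using l(1) D by (force simp: a_def)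
  qed
  then have "\<forall>D\<in>?\<C>. \<exists>w. w \<in> K \<and> (\<forall>C\<in>?\<C>. 0 \<le> dot E w (real_vec (\<sigma> C))) \<and>
      0 < dot E w (real_vec (\<sigma> D))"
    by blast
  from bchoice[OF this] obtain w where w: "\<forall>D\<in>?\<C>. w D \<in> K \<and>
      (\<forall>C\<in>?\<C>. 0 \<le> dot E (w D) (real_vec (\<sigma> C))) \<and> 0 < dot E (w D) (real_vec (\<sigma> D))"
    by blast
  define v where "v = (\<lambda>e. \<Sum>D\<in>?\<C>. 1 * w D e)"
  have "dot E v (real_vec (\<sigma> C)) = (\<Sum>D\<in>?\<C>. dot E (w D) (real_vec (\<sigma> C)))" for C
    unfolding v_def dot_def sum_distrib_right by (subst sum.swap) simp
  moreover have "0 < (\<Sum>D\<in>?\<C>. dot E (w D) (real_vec (\<sigma> C)))" if "C \<in> ?\<C>" for C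
    using that w fin by (intro sum_pos2[of _ C]) auto
  moreover have "v \<in> K" unfolding v_def by (rule sum_in[OF fin]) (use w in blast)
  ultimately show ?thesis by (intro that[of v]) simp_all
qed

end

section \<open>Signatures induced by a weight\<close>

locale weighted_signature = orthogonal_pair E K R
  for E :: "'e set" and K R :: "('e \<Rightarrow> real) set" +
  fixes \<sigma> :: "'e set \<Rightarrow> 'e \<Rightarrow> int" and w :: "'e \<Rightarrow> real"
  assumes sig: "signature (circuits E (independent_sets E K)) (signed_circuits_of E K) \<sigma>"
    and weight_in: "w \<in> K"
    and weight_pos: "\<And>C. C \<in> circuits E (independent_sets E K) \<Longrightarrow> 0 < dot E w (real_vec (\<sigma> C))"
begin

lemma signature_in:
  assumes "C \<in> circuits E (independent_sets E K)"
  shows "\<sigma> C \<in> signed_circuits_of E K" "supp (\<sigma> C) = C" "real_vec (\<sigma> C) \<in> K"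
  using sig assms by (auto simp: signature_def signed_circuits_of_def)

lemma signed_circuit_uminus: "x \<in> signed_circuits_of E K \<Longrightarrow> (\<lambda>e. - x e) \<in> signed_circuits_of E K"
  using scale_in[of "real_vec x" "-1"]
  by (auto simp: signed_circuits_of_def sign_vectors_def supp_def)

lemma signed_circuit_entry: "x \<in> signed_circuits_of E K \<Longrightarrow> x e \<noteq> 0 \<Longrightarrow> x e = 1 \<or> x e = -1"
  by (auto simp: signed_circuits_of_def sign_vectors_def)

text \<open>
  A circuit vector is determined by its support up to a scalar, and the entries \<open>1\<close>, \<open>-1\<close> leave
  only a sign.
\<close>

lemma signed_circuit_cases:
  assumes x: "x \<in> signed_circuits_of E K"
  obtains C where "C \<in> circuits E (independent_sets E K)" "x = \<sigma> C"
  | C where "C \<in> circuits E (independent_sets E K)" "x = (\<lambda>e. - \<sigma> C e)"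
proof -
  let ?s = "\<sigma> (supp x)"
  have C: "supp x \<in> circuits E (independent_sets E K)" and xK: "real_vec x \<in> K"
    using x by (auto simp: signed_circuits_of_def)
  note s = signature_in[OF C]
  obtain e where e: "x e \<noteq> 0" using x by (auto simp: signed_circuits_of_def supp_def)
  have se: "?s e \<noteq> 0" using s(2) e by (auto simp: supp_def)
  have "real_vec x d * real_vec ?s e = real_vec x e * real_vec ?s d" for d
  proof (rule circuit_proportional[OF C xK _ s(3)])
    fix d assume d: "d \<notin> supp x"
    then show "real_vec x d = 0" by (simp add: supp_def)
    show "real_vec ?s d = 0" using d s(2) by (auto simp: supp_def)
  qed
  then have eq: "x d * ?s e = x e * ?s d" for d by (simp flip: of_int_mult)
  consider "x e = ?s e" | "x e = - ?s e"
    using signed_circuit_entry[OF x e] signed_circuit_entry[OF s(1) se] by auto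
  then show ?thesis
  proof cases
    case 1
    then have "x = ?s" using eq se by (metis ext mult.commute mult_cancel_left)
    then show ?thesis using that(1) C by blast
  next
    case 2
    have "x d = - ?s d" for d using eq[of d] se 2 by (metis mult_minus_left mult.commute mult_cancel_right)
    then show ?thesis using that(2) C by blast
  qed
qed

lemma conformal_signed_circuit:
  assumes "k \<in> K" "k d \<noteq> 0"
  obtains x where "x \<in> signed_circuits_of E K" "\<And>e. x e \<noteq> 0 \<Longrightarrow> 0 < real_vec x e * k e"
proof -
  obtain h where h: "h \<in> K" "\<And>e. h e \<noteq> 0 \<Longrightarrow> 0 < h e * k e"
      "{e. h e \<noteq> 0} \<in> circuits E (independent_sets E K)"
    using conformal_circuit_vector[OF assms] by blast
  define s where "s = \<sigma> {e. h e \<noteq> 0}"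
  note s = signature_in[OF h(3), folded s_def]
  have sh: "s e \<noteq> 0 \<longleftrightarrow> h e \<noteq> 0" for e using s(2) by (auto simp: supp_def)
  obtain e0 where e0: "s e0 \<noteq> 0" using s(1) by (auto simp: signed_circuits_of_def supp_def)
  have eq: "h e * real_vec s e0 = h e0 * real_vec s e" for e
    by (rule circuit_proportional[OF h(3) h(1) _ s(3)]) (use sh in auto)
  have same: "0 < (real_vec s e * h e) * (real_vec s e0 * h e0)" if "s e \<noteq> 0" for e
  proof -
    have "(real_vec s e * h e) * (real_vec s e0 * h e0) = (h e0 * real_vec s e)\<^sup>2"
      using eq[of e] by (simp add: power2_eq_square algebra_simps)
    then show ?thesis using that e0 sh by simp
  qed
  have conformal: "0 < a * k e" if "0 < a * h e" for a e
  proof -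
    have "h e \<noteq> 0" using that by auto
    then have "0 < (a * h e) * (h e * k e)" using that h(2) by simp
    also have "\<dots> = (a * k e) * (h e * h e)" by (simp add: algebra_simps)
    finally show ?thesis by (rule zero_less_mult_pos2) (use \<open>h e \<noteq> 0\<close> not_real_square_gt_zero[of "h e"] in blast)
  qed
  show ?thesis
  proof (cases "0 < real_vec s e0 * h e0")
    case True
    show ?thesis
      by (rule that[OF s(1)], rule conformal, rule zero_less_mult_pos2[OF same True])
  next
    case False
    show ?thesis
    proof (rule that[OF signed_circuit_uminus[OF s(1)]], rule conformal)
      fix e assume "- s e \<noteq> 0"
      then have "0 < (- (real_vec s e * h e)) * (- (real_vec s e0 * h e0))"
        using same[of e] by simp
      moreover have "real_vec s e0 * h e0 \<noteq> 0" using same[OF e0] by auto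
      then have "0 < - (real_vec s e0 * h e0)" using False by linarith
      ultimately have "0 < - (real_vec s e * h e)" by (rule zero_less_mult_pos2)
      then show "0 < real_vec (\<lambda>e. - s e) e * h e" by simp
    qed
  qed
qed

text \<open>
  Peeling off conformal signed circuits decomposes \<open>k\<close> into a nonnegative combination of signed
  circuits that are compatible with \<open>\<O>\<close>, hence of the form \<open>\<sigma>(C)\<close>.
\<close>

lemma weight_nonneg_on_orthant:
  assumes O: "\<O> \<in> orientations E"
    and comp: "sig_compatible (circuits E (independent_sets E K)) (signed_circuits_of E K) \<sigma> \<O>"
    and k: "k \<in> K" "\<And>e. e \<in> E \<Longrightarrow> 0 \<le> real_vec \<O> e * k e"
  shows "0 \<le> dot E w k"
  using k
proof (induction "card {e. k e \<noteq> 0}" arbitrary: k rule: less_induct)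
  case less
  note k = less.prems
  show ?case
  proof (cases "\<exists>d. k d \<noteq> 0")
    case False
    then show ?thesis by (simp add: dot_def)
  next
    case True
    then obtain x where x: "x \<in> signed_circuits_of E K" "\<And>e. x e \<noteq> 0 \<Longrightarrow> 0 < real_vec x e * k e"
      using conformal_signed_circuit[OF k(1)] by metis
    have xK: "real_vec x \<in> K" using x by (auto simp: signed_circuits_of_def)
    have "compatible \<O> x" unfolding compatible_def
    proof
      fix e assume "e \<in> supp x"
      then have e: "x e \<noteq> 0" by (simp add: supp_def)
      then have "e \<in> E" using outside[OF xK] by force
      then have "\<O> e = 1 \<or> \<O> e = -1" "0 \<le> real_vec \<O> e * k e"
        using O k(2) by (auto simp: orientations_def)
      then show "\<O> e = x e" using signed_circuit_entry[OF x(1) e] x(2)[OF e] by auto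
    qed
    then have pos: "0 < dot E w (real_vec x)"
      using comp x(1) weight_pos unfolding sig_compatible_def by blast
    obtain e0 where e0: "x e0 \<noteq> 0" using x(1) by (auto simp: signed_circuits_of_def supp_def)
    then have e0E: "e0 \<in> E" using outside[OF xK] by force
    have sub: "\<And>e. k e = 0 \<Longrightarrow> real_vec x e = 0" using x(2) by force
    obtain t where t: "0 < t"
        "\<And>e. e \<in> E \<Longrightarrow> k e - t * real_vec x e \<noteq> 0 \<Longrightarrow> 0 < (k e - t * real_vec x e) * k e"
        "\<exists>e\<in>E. k e \<noteq> 0 \<and> k e - t * real_vec x e = 0"
      using conformal_reduction[where k = k and h = "real_vec x", OF finite_E sub e0E x(2)[OF e0]]
      by blast
    define k' where "k' e = k e - t * real_vec x e" for e
    have k'K: "k' \<in> K" using combination_in[OF k(1) xK, of "- t"] by (simp add: k'_def[abs_def])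
    have "{e. k' e \<noteq> 0} \<subset> {e. k e \<noteq> 0}" using t(3) sub by (force simp: k'_def)
    moreover have "finite {e. k e \<noteq> 0}"
      using finite_E outside[OF k(1)] by (metis (mono_tags) finite_subset mem_Collect_eq subsetI)
    ultimately have "card {e. k' e \<noteq> 0} < card {e. k e \<noteq> 0}" by (simp add: psubset_card_mono)
    moreover have "0 \<le> real_vec \<O> e * k' e" if e: "e \<in> E" for e
      using t(2)[OF e] k(2)[OF e]
      by (cases "k' e = 0") (auto simp: k'_def zero_less_mult_iff zero_le_mult_iff)
    ultimately have "0 \<le> dot E w k'" using less.hyps k'K by blast
    moreover have "dot E w k' = dot E w k - t * dot E w (real_vec x)"
      using dot_linear[of E w k "- t" "real_vec x"] by (simp add: k'_def[abs_def])
    ultimately show ?thesis using t(1) pos by (smt (verit) mult_pos_pos)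
  qed
qed

text \<open>
  The fundamental circuit meets \<open>E - B\<close> only in \<open>e\<close>, so there \<open>z\<close> sees exactly the weight of
  \<open>\<sigma>(C(B,e))\<close>. Such a \<open>z\<close> is the vector of reduced costs of the simplex method.
\<close>

lemma reduced_weight_fund_circuit:
  assumes B: "B \<in> bases (independent_sets E K)" and e: "e \<in> E - B"
    and z: "\<And>e. e \<in> B \<Longrightarrow> z e = 0" "(\<lambda>e. w e - z e) \<in> R"
  shows "0 < z e * real_vec (\<sigma> (fund_circuit E (independent_sets E K) B e)) e"
proof -
  let ?s = "\<sigma> (fund_circuit E (independent_sets E K) B e)"
  note C = fund_circuit[OF B e]
  note s = signature_in[OF C(1)]
  have "dot E z (real_vec ?s) = (\<Sum>d\<in>{e}. z d * real_vec ?s d)"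
    unfolding dot_def
  proof (rule sum.mono_neutral_right[OF finite_E])
    show "\<forall>d\<in>E - {e}. z d * real_vec ?s d = 0"
    proof
      fix d assume d: "d \<in> E - {e}"
      show "z d * real_vec ?s d = 0"
      proof (cases "d \<in> B")
        case False
        then have "d \<notin> supp ?s" using s(2) C(2) d by auto
        then show ?thesis by (simp add: supp_def)
      qed (simp add: z)
    qed
  qed (use e in auto)
  moreover have "dot E w (real_vec ?s) = dot E z (real_vec ?s)"
    by (rule dot_cong_orthogonal[OF z(2) s(3)])
  ultimately show ?thesis using weight_pos[OF C(1)] by simp
qed

text \<open>
  A vector of \<open>K\<close> is determined by its restriction to \<open>E - B\<close>, so on \<open>K\<close> the weight is a linear
  combination of the coordinates outside \<open>B\<close>.
\<close>

lemma reduced_weight_exists: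
  assumes B: "B \<in> bases (independent_sets E K)"
  obtains z where "\<And>e. e \<notin> E - B \<Longrightarrow> z e = 0" "(\<lambda>e. w e - z e) \<in> R"
proof -
  have fin: "finite (E - B)" using finite_E by simp
  have Bi: "B \<in> independent_sets E K" using B by (simp add: bases_iff)
  have "\<exists>c. \<forall>k\<in>K. dot E w k = (\<Sum>e\<in>E - B. c e * k e)"
  proof (rule functional_in_span_if_kernel_subset[OF fin])
    fix x y :: "'e \<Rightarrow> real" and c assume xy: "x \<in> K" "y \<in> K"
    show "\<exists>z\<in>K. (\<forall>e\<in>E - B. z e = x e + c * y e) \<and> dot E w z = dot E w x + c * dot E w y"
      by (rule bexI[OF _ combination_in[OF xy, of c]]) (simp add: dot_linear)
  next
    fix k assume k: "k \<in> K" "\<forall>e\<in>E - B. k e = 0"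
    have "k d = 0" if "d \<notin> B" for d using that k(2) outside[OF k(1), of d] by blast
    then have "k e = 0" for e by (rule independent_not_vanishing[OF Bi k(1)])
    then show "dot E w k = 0" by (simp add: dot_def)
  qed
  then obtain c where c: "\<forall>k\<in>K. dot E w k = (\<Sum>e\<in>E - B. c e * k e)" by blast
  define z where "z e = (if e \<in> E - B then c e else 0)" for e
  have "dot E z k = (\<Sum>e\<in>E - B. c e * k e)" for k
    unfolding dot_def using finite_E by (intro sum.mono_neutral_cong_right) (auto simp: z_def)
  then have "(\<lambda>e. w e - z e) \<in> R"
    unfolding R_iff using c outside[OF weight_in]
    by (auto simp: dot_diff dot_commute[of E _ w] dot_commute[of E _ z]) (simp add: z_def)
  moreover have "z e = 0" if "e \<notin> E - B" for e using that by (simp only: z_def if_False)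
  ultimately show ?thesis using that[of z] by blast
qed

text \<open>
  The reduced weight \<open>z\<close> has the same signs as \<open>\<O>\<close> outside \<open>B\<close> and agrees with \<open>w\<close> on \<open>K\<close>, so a
  signed circuit compatible with \<open>\<O>\<close> has nonnegative weight and cannot be \<open>-\<sigma>(C)\<close>.
\<close>

lemma fund_circuit_orientation_sig_compatible:
  assumes B: "B \<in> bases (independent_sets E K)"
    and O: "\<And>e. e \<in> E - B \<Longrightarrow> \<O> e = \<sigma> (fund_circuit E (independent_sets E K) B e) e"
  shows "sig_compatible (circuits E (independent_sets E K)) (signed_circuits_of E K) \<sigma> \<O>"
  unfolding sig_compatible_def
proof (intro ballI impI)
  fix x assume x: "x \<in> signed_circuits_of E K" "compatible \<O> x"
  obtain z where z: "\<And>e. e \<notin> E - B \<Longrightarrow> z e = 0" "(\<lambda>e. w e - z e) \<in> R"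
    using reduced_weight_exists[OF B] by blast
  from x(1) show "\<exists>C\<in>circuits E (independent_sets E K). x = \<sigma> C"
  proof (cases rule: signed_circuit_cases)
    case (2 C)
    have "dot E w (real_vec x) = - dot E w (real_vec (\<sigma> C))"
      by (simp add: 2 dot_def sum_negf)
    then have "dot E w (real_vec x) < 0" using weight_pos[OF 2(1)] by simp
    moreover have "real_vec x \<in> K" using x by (auto simp: signed_circuits_of_def)
    then have "dot E w (real_vec x) = dot E z (real_vec x)"
      by (rule dot_cong_orthogonal[OF z(2)])
    moreover have "0 \<le> dot E z (real_vec x)" unfolding dot_def
    proof (rule sum_nonneg)
      fix e assume e: "e \<in> E"
      show "0 \<le> z e * real_vec x e"
      proof (cases "e \<in> B \<or> x e = 0")
        case False
        then have "x e = \<sigma> (fund_circuit E (independent_sets E K) B e) e"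
          using x(2) O e by (auto simp: compatible_def supp_def)
        then show ?thesis using reduced_weight_fund_circuit[OF B _ z(1) z(2), of e] False e
          by simp
      qed (use z(1) in auto)
    qed
    ultimately show ?thesis by simp
  qed blast
qed

text \<open>
  On a circuit inside the zero set of \<open>z\<close> the weight would be zero.
\<close>

lemma independent_if_weight_vanishes:
  assumes z: "(\<lambda>e. w e - z e) \<in> R"
  shows "{e\<in>E. z e = 0} \<in> independent_sets E K"
proof (rule ccontr)
  assume "\<not> ?thesis"
  then obtain C where C: "C \<in> circuits E (independent_sets E K)" "C \<subseteq> {e\<in>E. z e = 0}"
    using circuit_in_dependent_set[of "{e\<in>E. z e = 0}"] by auto
  note s = signature_in[OF C(1)]
  have "dot E z (real_vec (\<sigma> C)) = 0"
    unfolding dot_def using s(2) C(2) by (intro sum.neutral) (auto simp: supp_def)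
  moreover have "dot E w (real_vec (\<sigma> C)) = dot E z (real_vec (\<sigma> C))"
    by (rule dot_cong_orthogonal[OF z s(3)])
  ultimately show False using weight_pos[OF C(1)] by simp
qed

text \<open>
  Reversing \<open>-\<sigma>(C)\<close> adds \<open>2 \<sigma>(C)\<close> to the orientation, which the weight \<open>w\<close> counts positively
  and \<open>v\<close>, being orthogonal to \<open>K\<close>, does not notice.
\<close>

lemma weight_increases_by_reversal:
  assumes not: "\<not> sig_compatible (circuits E (independent_sets E K)) (signed_circuits_of E K) \<sigma> \<O>"
    and v: "v \<in> R"
  obtains x where "x \<in> signed_circuits_of E K" "compatible \<O> x"
    "dot E (\<lambda>e. w e + v e) (real_vec \<O>) < dot E (\<lambda>e. w e + v e) (real_vec (reversal \<O> x))"
proof -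
  obtain x where x: "x \<in> signed_circuits_of E K" "compatible \<O> x"
      "\<not> (\<exists>C\<in>circuits E (independent_sets E K). x = \<sigma> C)"
    using not unfolding sig_compatible_def by blast
  from x(1,3) obtain C where C: "C \<in> circuits E (independent_sets E K)" "x = (\<lambda>e. - \<sigma> C e)"
    by (cases rule: signed_circuit_cases) auto
  let ?u = "\<lambda>e. w e + v e"
  have "real_vec (reversal \<O> x) = (\<lambda>e. real_vec \<O> e + 2 * real_vec (\<sigma> C) e)"
    using x(2) by (auto simp: reversal_def compatible_def C(2) supp_def)
  then have "dot E ?u (real_vec (reversal \<O> x)) = dot E ?u (real_vec \<O>) + 2 * dot E ?u (real_vec (\<sigma> C))"
    by (simp add: dot_linear)
  moreover have "dot E ?u (real_vec (\<sigma> C)) = dot E w (real_vec (\<sigma> C))"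
    using dot_linear_left[of E w 1 v "real_vec (\<sigma> C)"] orthogonal[OF signature_in(3)[OF C(1)] v]
    by (simp add: dot_commute)
  ultimately show ?thesis using that[OF x(1,2)] weight_pos[OF C(1)] by simp
qed

text \<open>
  A signed circuit conformal to \<open>k\<close> is compatible with \<open>\<O>\<close> and its negative with \<open>\<O>'\<close>, but \<open>\<sigma>\<close>
  contains only one of the two.
\<close>

lemma no_common_conformal_vector:
  assumes comp: "sig_compatible (circuits E (independent_sets E K)) (signed_circuits_of E K) \<sigma> \<O>"
      "sig_compatible (circuits E (independent_sets E K)) (signed_circuits_of E K) \<sigma> \<O>'"
    and O: "\<O> \<in> orientations E" "\<O>' \<in> orientations E"
    and k: "k \<in> K" "\<And>e. k e \<noteq> 0 \<Longrightarrow> 0 < real_vec \<O> e * k e \<and> real_vec \<O>' e * k e < 0"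
  shows "k d = 0"
proof (rule ccontr)
  assume "k d \<noteq> 0"
  then obtain x where x: "x \<in> signed_circuits_of E K" "\<And>e. x e \<noteq> 0 \<Longrightarrow> 0 < real_vec x e * k e"
    using conformal_signed_circuit[OF k(1)] by blast
  have xk: "x e = \<O> e \<and> - x e = \<O>' e" if e: "x e \<noteq> 0" for e
  proof -
    have k0: "k e \<noteq> 0" using x(2)[OF e] by auto
    then have "e \<in> E" using outside[OF k(1)] by blast
    then have "\<O> e = 1 \<or> \<O> e = -1" "\<O>' e = 1 \<or> \<O>' e = -1" using O by (auto simp: orientations_def)
    then show ?thesis using signed_circuit_entry[OF x(1) e] x(2)[OF e] k(2)[OF k0] by auto
  qed
  have "compatible \<O> x" using xk by (auto simp: compatible_def supp_def)
  then obtain C where C: "C \<in> circuits E (independent_sets E K)" "x = \<sigma> C"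
    using comp(1) x(1) unfolding sig_compatible_def by blast
  have "compatible \<O>' (\<lambda>e. - x e)" using xk by (force simp: compatible_def supp_def)
  then obtain D where D: "D \<in> circuits E (independent_sets E K)" "(\<lambda>e. - x e) = \<sigma> D"
    using comp(2) signed_circuit_uminus[OF x(1)] unfolding sig_compatible_def by blast
  have "supp x = C" "supp (\<lambda>e. - x e) = D" using signature_in(2) C D by auto
  then have "C = D" by (auto simp: supp_def)
  then have "(\<lambda>e. - x e) = x" using C D by simp
  then have "x e = 0" for e by (metis neg_equal_zero)
  then show False using x(1) by (auto simp: signed_circuits_of_def supp_def)
qed

end

section \<open>Pairs of signatures\<close>

lemma orientation_entry: "\<O> \<in> orientations E \<Longrightarrow> e \<in> E \<Longrightarrow> \<O> e = 1 \<or> \<O> e = -1"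
  by (auto simp: orientations_def dest: PiE_mem)

locale weighted_signature_pair =
  circ: weighted_signature E K R \<sigma> w + cocirc: weighted_signature E R K \<sigma>s ws
  for E :: "'e set" and K R :: "('e \<Rightarrow> real) set"
    and \<sigma> \<sigma>s :: "'e set \<Rightarrow> 'e \<Rightarrow> int" and w ws :: "'e \<Rightarrow> real"
begin

abbreviation M :: "'e set set" where "M \<equiv> independent_sets E K"

abbreviation \<beta> :: "'e set \<Rightarrow> 'e \<Rightarrow> int" where "\<beta> \<equiv> basis_orientation E M \<sigma> \<sigma>s"

definition compatible_set :: "('e \<Rightarrow> int) set" where
  "compatible_set = {\<O> \<in> orientations E.
     sig_compatible (circuits E M) (signed_circuits_of E K) \<sigma> \<O> \<and>
     sig_compatible (circuits E (independent_sets E R)) (signed_circuits_of E R) \<sigma>s \<O>}"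

lemma cocircuits_eq: "cocircuits E M = circuits E (independent_sets E R)"
  by (simp add: cocircuits_def circ.dual_matroid_eq)

lemma fund_cocircuit_eq:
  "fund_cocircuit E M B e = fund_circuit E (independent_sets E R) (E - B) e"
  by (simp add: fund_cocircuit_def fund_circuit_def cocircuits_eq)

lemma cobasis: "B \<in> bases M \<Longrightarrow> E - B \<in> bases (independent_sets E R)"
  by (simp add: circ.bases_iff cocirc.bases_iff double_diff)

lemma basis_orientation_off:
  "e \<in> E - B \<Longrightarrow> \<beta> B e = \<sigma> (fund_circuit E M B e) e"
  by (simp add: basis_orientation_def)

lemma basis_orientation_on:
  "B \<subseteq> E \<Longrightarrow> e \<in> B \<Longrightarrow> \<beta> B e = \<sigma>s (fund_circuit E (independent_sets E R) (E - B) e) e"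
  by (auto simp: basis_orientation_def fund_cocircuit_eq)

lemma basis_orientation_in_orientations:
  assumes B: "B \<in> bases M"
  shows "\<beta> B \<in> orientations E"
proof -
  have "\<beta> B e \<in> {-1, 1}" if e: "e \<in> E" for e
  proof (cases "e \<in> B")
    case True
    have BE: "B \<subseteq> E" using B by (simp add: circ.bases_iff)
    have eB: "e \<in> E - (E - B)" using e True by blast
    note C = cocirc.fund_circuit[OF cobasis[OF B] eB]
    note s = cocirc.signature_in[OF C(1)]
    have "\<beta> B e \<noteq> 0"
      using s(2) C(3) by (auto simp: basis_orientation_on[OF BE True] supp_def)
    then show ?thesis
      using cocirc.signed_circuit_entry[OF s(1)] by (auto simp: basis_orientation_on[OF BE True])
  next
    case False
    then have eB: "e \<in> E - B" using e by blast
    note C = circ.fund_circuit[OF B eB]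
    note s = circ.signature_in[OF C(1)]
    have "\<beta> B e \<noteq> 0" using s(2) C(3) by (auto simp: basis_orientation_off[OF eB] supp_def)
    then show ?thesis
      using circ.signed_circuit_entry[OF s(1)] by (auto simp: basis_orientation_off[OF eB])
  qed
  then show ?thesis by (auto simp: orientations_def basis_orientation_def)
qed

lemma basis_orientation_compatible:
  assumes B: "B \<in> bases M"
  shows "\<beta> B \<in> compatible_set"
proof -
  have BE: "B \<subseteq> E" using B by (simp add: circ.bases_iff)
  have "sig_compatible (circuits E M) (signed_circuits_of E K) \<sigma> (\<beta> B)"
    by (rule circ.fund_circuit_orientation_sig_compatible[OF B]) (rule basis_orientation_off)
  moreover have
    "sig_compatible (circuits E (independent_sets E R)) (signed_circuits_of E R) \<sigma>s (\<beta> B)"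
    by (rule cocirc.fund_circuit_orientation_sig_compatible[OF cobasis[OF B]],
        rule basis_orientation_on[OF BE]) blast
  ultimately show ?thesis
    using basis_orientation_in_orientations[OF B] by (simp add: compatible_set_def)
qed

lemma reduced_weights_exist:
  assumes B: "B \<in> bases M"
  obtains x z where
    "(\<lambda>e. ws e - x e) \<in> K" "\<And>e. e \<notin> B \<Longrightarrow> x e = 0" "\<And>e. e \<in> B \<Longrightarrow> 0 < x e * real_vec (\<beta> B) e"
    "(\<lambda>e. w e - z e) \<in> R" "\<And>e. e \<notin> E - B \<Longrightarrow> z e = 0"
    "\<And>e. e \<in> E - B \<Longrightarrow> 0 < z e * real_vec (\<beta> B) e"
proof -
  have BE: "B \<subseteq> E" using B by (simp add: circ.bases_iff)
  obtain z where z: "\<And>e. e \<notin> E - B \<Longrightarrow> z e = 0" "(\<lambda>e. w e - z e) \<in> R"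
    using circ.reduced_weight_exists[OF B] by blast
  obtain x where x0: "\<And>e. e \<notin> E - (E - B) \<Longrightarrow> x e = 0" "(\<lambda>e. ws e - x e) \<in> K"
    using cocirc.reduced_weight_exists[OF cobasis[OF B]] by blast
  have x: "x e = 0" if "e \<notin> B" for e by (rule x0(1)) (use that in blast)
  show ?thesis
  proof (rule that[OF x0(2) x _ z(2,1)])
    fix e assume e: "e \<in> B"
    have "0 < x e * real_vec (\<sigma>s (fund_circuit E (independent_sets E R) (E - B) e)) e"
      by (rule cocirc.reduced_weight_fund_circuit[OF cobasis[OF B] _ _ x0(2)])
        (use e BE x in auto)
    then show "0 < x e * real_vec (\<beta> B) e" by (simp add: basis_orientation_on[OF BE e])
  next
    fix e assume e: "e \<in> E - B"
    have "0 < z e * real_vec (\<sigma> (fund_circuit E M B e)) e"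
      by (rule circ.reduced_weight_fund_circuit[OF B e _ z(2)]) (use z(1) in auto)
    then show "0 < z e * real_vec (\<beta> B) e" by (simp add: basis_orientation_off[OF e])
  qed auto
qed

text \<open>
  Uniqueness of a nondegenerate optimal basis. By orthogonality of \<open>x' - x\<close> and \<open>z' - z\<close>, two
  complementary pairs of solutions are also complementary crosswise, so \<open>z'\<close> vanishes where \<open>x\<close>
  does not.
\<close>

lemma basis_subset_if_same_orientation:
  assumes B: "B \<in> bases M" and D: "D \<in> bases M" and eq: "\<beta> B = \<beta> D"
  shows "B \<subseteq> D"
proof
  fix b assume b: "b \<in> B"
  have BE: "B \<subseteq> E" "D \<subseteq> E" using B D by (simp_all add: circ.bases_iff)
  obtain x z where x: "(\<lambda>e. ws e - x e) \<in> K" "\<And>e. e \<notin> B \<Longrightarrow> x e = 0"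
      "\<And>e. e \<in> B \<Longrightarrow> 0 < x e * real_vec (\<beta> B) e"
    and z: "(\<lambda>e. w e - z e) \<in> R" "\<And>e. e \<notin> E - B \<Longrightarrow> z e = 0"
      "\<And>e. e \<in> E - B \<Longrightarrow> 0 < z e * real_vec (\<beta> B) e"
    by (rule reduced_weights_exist[OF B]) (rule that)
  obtain x' z' where x': "(\<lambda>e. ws e - x' e) \<in> K" "\<And>e. e \<notin> D \<Longrightarrow> x' e = 0"
      "\<And>e. e \<in> D \<Longrightarrow> 0 < x' e * real_vec (\<beta> D) e"
    and z': "(\<lambda>e. w e - z' e) \<in> R" "\<And>e. e \<notin> E - D \<Longrightarrow> z' e = 0"
      "\<And>e. e \<in> E - D \<Longrightarrow> 0 < z' e * real_vec (\<beta> D) e"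
    by (rule reduced_weights_exist[OF D]) (rule that)
  note x' = x'[folded eq] and z' = z'[folded eq]
  have "(\<lambda>e. x' e - x e) \<in> K" using circ.diff_in[OF x(1) x'(1)] by simp
  moreover have "(\<lambda>e. z' e - z e) \<in> R" using cocirc.diff_in[OF z(1) z'(1)] by simp
  ultimately have "dot E (\<lambda>e. x' e - x e) (\<lambda>e. z' e - z e) = 0" by (rule circ.orthogonal)
  moreover have "dot E x z = 0" unfolding dot_def
    by (rule sum.neutral) (use x(2) z(2) in fastforce)
  moreover have "dot E x' z' = 0" unfolding dot_def
    by (rule sum.neutral) (use x'(2) z'(2) in fastforce)
  ultimately have sum0: "dot E x z' + dot E x' z = 0" by (simp add: dot_diff dot_diff_left)
  have sign: "0 \<le> p * q" if "0 \<le> p * real_vec (\<beta> B) e" "0 \<le> q * real_vec (\<beta> B) e" "e \<in> E"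
    for p q :: real and e
  proof -
    have "\<beta> B e = -1 \<or> \<beta> B e = 1"
      using basis_orientation_in_orientations[OF B] that(3) by (auto simp: orientations_def)
    then show ?thesis using that(1,2) by (auto intro: mult_nonneg_nonneg mult_nonpos_nonpos)
  qed
  have xs: "0 \<le> x e * real_vec (\<beta> B) e" for e using x(2,3)[of e] by (cases "e \<in> B") auto
  have xs': "0 \<le> x' e * real_vec (\<beta> B) e" for e using x'(2,3)[of e] by (cases "e \<in> D") auto
  have zs: "0 \<le> z e * real_vec (\<beta> B) e" for e using z(2,3)[of e] by (cases "e \<in> E - B") auto
  have zs': "0 \<le> z' e * real_vec (\<beta> B) e" for e using z'(2,3)[of e] by (cases "e \<in> E - D") auto
  have nonneg: "0 \<le> x e * z' e" "0 \<le> x' e * z e" if "e \<in> E" for e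
    using sign[OF xs zs' that] sign[OF xs' zs that] by simp_all
  have "0 \<le> dot E x z'" "0 \<le> dot E x' z" unfolding dot_def by (auto intro!: sum_nonneg nonneg)
  then have "dot E x z' = 0" using sum0 by linarith
  then have "x b * z' b = 0"
    unfolding dot_def using sum_nonneg_eq_0_iff[OF circ.finite_E nonneg(1)] b BE(1) by auto
  moreover have "x b \<noteq> 0" using x(3)[OF b] by auto
  ultimately have "z' b = 0" by simp
  then have "b \<notin> E - D" using z'(3)[of b] by auto
  then show "b \<in> D" using b BE(1) by blast
qed

text \<open>
  Strong duality of linear programming, relative to the orthant of \<open>\<O>\<close>. For \<open>x \<in> ws + K\<close>
  and \<open>z \<in> w + R\<close>, orthogonality of \<open>K\<close> and \<open>R\<close> makes \<open>x \<bullet> z = x \<bullet> w + z \<bullet> ws\<close> linear, so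
  that membership, signs and \<open>x \<bullet> z \<le> 0\<close> form one linear system, to which Farkas' lemma applies.
  An infeasibility certificate would be a triple \<open>(y, k, t)\<close> with \<open>y \<in> R\<close>, \<open>k \<in> K\<close>, \<open>t \<ge> 0\<close>,
  with \<open>y + t w\<close> and \<open>k + t ws\<close> in the orthant and \<open>ws \<bullet> y + w \<bullet> k < 0\<close>. For \<open>t = 0\<close> it is
  excluded by the compatibility of \<open>\<O>\<close>, and for \<open>t > 0\<close> because
  \<open>(y + t w) \<bullet> (k + t ws) = t (ws \<bullet> y + w \<bullet> k)\<close>.
\<close>

lemma complementary_solutions:
  assumes O: "\<O> \<in> compatible_set"
  obtains x z where "(\<lambda>e. ws e - x e) \<in> K" "(\<lambda>e. w e - z e) \<in> R"
    "\<And>e. 0 \<le> x e * real_vec \<O> e" "\<And>e. 0 \<le> z e * real_vec \<O> e" "\<And>e. e \<in> E \<Longrightarrow> x e * z e = 0"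
proof -
  let ?o = "real_vec \<O>"
  have Oo: "\<O> \<in> orientations E"
    and Oc: "sig_compatible (circuits E M) (signed_circuits_of E K) \<sigma> \<O>"
    and Od: "sig_compatible (circuits E (independent_sets E R)) (signed_circuits_of E R) \<sigma>s \<O>"
    using O by (simp_all add: compatible_set_def)
  have sq: "?o e * ?o e = 1" if "e \<in> E" for e
    using orientation_entry[OF Oo that] by auto
  have wws: "dot E w ws = 0" by (rule circ.orthogonal[OF circ.weight_in cocirc.weight_in])
  define I where "I = (E <+> E) <+> {()}"
  define \<alpha> :: "('e + 'e) + unit \<Rightarrow> ('e \<Rightarrow> real) \<times> ('e \<Rightarrow> real) \<times> real \<Rightarrow> real" where
    "\<alpha> i = (\<lambda>(y, k, t). case i of
        Inl (Inl e) \<Rightarrow> ?o e * (y e + t * w e)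
      | Inl (Inr e) \<Rightarrow> ?o e * (k e + t * ws e)
      | Inr _ \<Rightarrow> t)" for i
  define \<gamma> :: "('e \<Rightarrow> real) \<times> ('e \<Rightarrow> real) \<times> real \<Rightarrow> real" where
    "\<gamma> = (\<lambda>(y, k, t). dot E ws y + dot E w k)"
  have mem: "e \<in> E \<Longrightarrow> Inl (Inl e) \<in> I" "e \<in> E \<Longrightarrow> Inl (Inr e) \<in> I" "Inr () \<in> I" for e
    by (auto simp: I_def)
  \<comment> \<open>The three blocks of multipliers are the coordinates of x, those of z, and the slack of the last inequality.\<close>
  have I_split: "(\<Sum>i\<in>I. f i) =
      (\<Sum>e\<in>E. f (Inl (Inl e))) + (\<Sum>e\<in>E. f (Inl (Inr e))) + f (Inr ())" for f :: "_ \<Rightarrow> real"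
    unfolding I_def using circ.finite_E by (simp add: sum.Plus)
  have "\<exists>l. (\<forall>i\<in>I. 0 \<le> l i) \<and> (\<forall>p\<in>R \<times> K \<times> UNIV. \<gamma> p = (\<Sum>i\<in>I. l i * \<alpha> i p))"
  proof (rule farkas_functionals)
    show "finite I" unfolding I_def using circ.finite_E by simp
  next
    fix p q c assume p: "p \<in> R \<times> K \<times> (UNIV :: real set)" and q: "q \<in> R \<times> K \<times> (UNIV :: real set)"
    obtain y k t where p': "p = (y, k, t)" "y \<in> R" "k \<in> K" using p by auto
    obtain y' k' t' where q': "q = (y', k', t')" "y' \<in> R" "k' \<in> K" using q by auto
    let ?z = "(\<lambda>e. y e + c * y' e, \<lambda>e. k e + c * k' e, t + c * t')"
    have "?z \<in> R \<times> K \<times> UNIV"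
      using cocirc.combination_in[OF p'(2) q'(2)] circ.combination_in[OF p'(3) q'(3)] by simp
    moreover have "\<alpha> i ?z = \<alpha> i p + c * \<alpha> i q" for i
      by (simp add: \<alpha>_def p' q' algebra_simps split: sum.split)
    moreover have "\<gamma> ?z = \<gamma> p + c * \<gamma> q"
      by (simp add: \<gamma>_def p' q' dot_linear distrib_left)
    ultimately show "\<exists>z\<in>R \<times> K \<times> UNIV. (\<forall>i\<in>I. \<alpha> i z = \<alpha> i p + c * \<alpha> i q) \<and> \<gamma> z = \<gamma> p + c * \<gamma> q"
      by blast
  next
    fix p assume p: "p \<in> R \<times> K \<times> (UNIV :: real set)" and pos: "\<forall>i\<in>I. 0 \<le> \<alpha> i p"
    obtain y k t where p': "p = (y, k, t)" "y \<in> R" "k \<in> K" using p by auto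
    define y' where "y' = (\<lambda>e. y e + t * w e)"
    define k' where "k' = (\<lambda>e. k e + t * ws e)"
    have y'_pos: "0 \<le> ?o e * y' e" if "e \<in> E" for e
      using bspec[OF pos mem(1)[OF that]] by (simp add: \<alpha>_def p' y'_def)
    have k'_pos: "0 \<le> ?o e * k' e" if "e \<in> E" for e
      using bspec[OF pos mem(2)[OF that]] by (simp add: \<alpha>_def p' k'_def)
    have t: "0 \<le> t" using bspec[OF pos mem(3)] by (simp add: \<alpha>_def p')
    have "0 \<le> dot E ws y + dot E w k"
    proof (cases "t = 0")
      case True
      have "0 \<le> dot E ws y"
        by (rule cocirc.weight_nonneg_on_orthant[OF Oo Od p'(2)])
          (use y'_pos True in \<open>simp add: y'_def\<close>)
      moreover have "0 \<le> dot E w k"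
        by (rule circ.weight_nonneg_on_orthant[OF Oo Oc p'(3)])
          (use k'_pos True in \<open>simp add: k'_def\<close>)
      ultimately show ?thesis by simp
    next
      case False
      have "0 \<le> y' e * k' e" if "e \<in> E" for e
      proof -
        have "0 \<le> (?o e * y' e) * (?o e * k' e)" using y'_pos k'_pos that by simp
        also have "\<dots> = (?o e * ?o e) * (y' e * k' e)" by (simp add: algebra_simps)
        finally show ?thesis by (simp add: sq[OF that])
      qed
      then have "0 \<le> dot E y' k'" unfolding dot_def by (rule sum_nonneg)
      also have "dot E y' k' = t * (dot E ws y + dot E w k)"
        using cocirc.orthogonal[OF p'(2,3)] wws
        by (simp add: y'_def k'_def dot_linear dot_linear_left dot_commute[of E y ws] distrib_left)
      finally show ?thesis using t False by (simp add: zero_le_mult_iff)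
    qed
    then show "0 \<le> \<gamma> p" by (simp add: \<gamma>_def p')
  qed
  then obtain l where l: "\<forall>i\<in>I. 0 \<le> l i"
      "\<And>p. p \<in> R \<times> K \<times> UNIV \<Longrightarrow> \<gamma> p = (\<Sum>i\<in>I. l i * \<alpha> i p)" by blast
  define x where "x e = (if e \<in> E then l (Inl (Inl e)) * ?o e else 0)" for e
  define z where "z e = (if e \<in> E then l (Inl (Inr e)) * ?o e else 0)" for e
  have x_dot: "(\<Sum>e\<in>E. l (Inl (Inl e)) * (?o e * f e)) = dot E x f" for f
    by (simp add: dot_def x_def mult.assoc)
  have z_dot: "(\<Sum>e\<in>E. l (Inl (Inr e)) * (?o e * f e)) = dot E z f" for f
    by (simp add: dot_def z_def mult.assoc)
  have main: "dot E ws y + dot E w k =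
      dot E x (\<lambda>e. y e + t * w e) + dot E z (\<lambda>e. k e + t * ws e) + l (Inr ()) * t"
    if "y \<in> R" "k \<in> K" for y k t
    using l(2)[of "(y, k, t)"] that by (simp add: \<gamma>_def \<alpha>_def I_split x_dot z_dot)
  have out: "x e = 0" "z e = 0" if "e \<notin> E" for e using that by (simp_all add: x_def z_def)
  \<comment> \<open>The test vectors (y, 0, 0), (0, k, 0) and (0, 0, 1) extract the three conditions.\<close>
  have "dot E ws y = dot E x y" if "y \<in> R" for y
    using main[OF that circ.zero_in, of 0] by (simp add: dot_def[of E _ "\<lambda>_. 0"])
  then have xK: "(\<lambda>e. ws e - x e) \<in> K"
    unfolding circ.K_iff using out cocirc.outside[OF cocirc.weight_in] by (simp add: dot_diff_left)
  have "dot E w k = dot E z k" if "k \<in> K" for k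
    using main[OF cocirc.zero_in that, of 0] by (simp add: dot_def[of E _ "\<lambda>_. 0"])
  then have zR: "(\<lambda>e. w e - z e) \<in> R"
    unfolding cocirc.K_iff using out circ.outside[OF circ.weight_in] by (simp add: dot_diff_left)
  have "dot E x w + dot E z ws \<le> 0"
    using main[OF cocirc.zero_in circ.zero_in, of 1] bspec[OF l(1) mem(3)]
    by (simp add: dot_def[of E _ "\<lambda>_. 0"])
  moreover have "dot E (\<lambda>e. ws e - x e) (\<lambda>e. w e - z e) = 0" by (rule circ.orthogonal[OF xK zR])
  then have "dot E x z = dot E x w + dot E z ws"
    using wws by (simp add: dot_diff dot_diff_left dot_commute[of E ws])
  ultimately have le: "dot E x z \<le> 0" by simp
  have x_pos: "0 \<le> x e * ?o e" for e
    using bspec[OF l(1) mem(1)] sq[of e] by (simp add: x_def mult.assoc)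
  have z_pos: "0 \<le> z e * ?o e" for e
    using bspec[OF l(1) mem(2)] sq[of e] by (simp add: z_def mult.assoc)
  have xz: "0 \<le> x e * z e" if "e \<in> E" for e
  proof -
    have "0 \<le> (x e * ?o e) * (z e * ?o e)" using x_pos z_pos by simp
    also have "\<dots> = (?o e * ?o e) * (x e * z e)" by (simp add: algebra_simps)
    finally show ?thesis by (simp add: sq[OF that])
  qed
  then have "dot E x z = 0" using le unfolding dot_def by (intro antisym sum_nonneg) auto
  then have "x e * z e = 0" if "e \<in> E" for e
    unfolding dot_def using sum_nonneg_eq_0_iff[OF circ.finite_E xz] that by auto
  then show ?thesis using that[OF xK zR x_pos z_pos] by blast
qed

text \<open>
  Take for \<open>B\<close> the zero set of \<open>z\<close>. It is independent since \<open>w\<close> is nonzero on circuits, and it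
  contains the support of \<open>x\<close>, whose complement is independent in the dual since \<open>ws\<close> is nonzero
  on cocircuits. So \<open>B\<close> is a basis, \<open>z\<close> and \<open>x\<close> are its reduced weights, and their signs,
  which are those of \<open>\<O>\<close>, are also those of \<open>\<O>(B)\<close>.
\<close>

lemma compatible_orientation_from_basis:
  assumes O: "\<O> \<in> compatible_set"
  obtains B where "B \<in> bases M" "\<beta> B = \<O>"
proof -
  have Oo: "\<O> \<in> orientations E" using O by (simp add: compatible_set_def)
  obtain x z where xz: "(\<lambda>e. ws e - x e) \<in> K" "(\<lambda>e. w e - z e) \<in> R"
    "\<And>e. 0 \<le> x e * real_vec \<O> e" "\<And>e. 0 \<le> z e * real_vec \<O> e" "\<And>e. e \<in> E \<Longrightarrow> x e * z e = 0"
    using complementary_solutions[OF O] by blast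
  define B where "B = {e \<in> E. z e = 0}"
  have BE: "B \<subseteq> E" by (simp add: B_def)
  have Bi: "B \<in> independent_sets E K"
    unfolding B_def by (rule circ.independent_if_weight_vanishes[OF xz(2)])
  have x0: "{e \<in> E. x e = 0} \<in> independent_sets E R"
    by (rule cocirc.independent_if_weight_vanishes[OF xz(1)])
  have "E - B \<subseteq> {e \<in> E. x e = 0}" using xz(5) by (auto simp: B_def)
  then have "E - B \<in> independent_sets E R" by (rule independent_sets_mono[OF _ x0])
  then have B: "B \<in> bases M" using BE Bi by (simp add: circ.bases_iff)
  have zB: "z e = 0" if "e \<in> B" for e using that by (simp add: B_def)
  have xB: "x e = 0" if "e \<in> E - B" for e using that xz(5)[of e] by (auto simp: B_def)
  have same: "a = b" if "a \<in> {-1, 1}" "b \<in> {-1, 1}" "0 < r * real_of_int a" "0 \<le> r * real_of_int b"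
    for a b :: int and r :: real
    using that by auto
  have "\<beta> B e = \<O> e" for e
  proof (cases "e \<in> E")
    case e: True
    then have entries: "\<beta> B e \<in> {-1, 1}" "\<O> e \<in> {-1, 1}"
      using Oo basis_orientation_in_orientations[OF B] by (auto simp: orientations_def)
    show ?thesis
    proof (cases "e \<in> B")
      case True
      have eB: "e \<in> E - (E - B)" using True e by blast
      show ?thesis
        using cocirc.reduced_weight_fund_circuit[OF cobasis[OF B] eB xB xz(1)]
        by (intro same[OF entries _ xz(3)]) (simp add: basis_orientation_on[OF BE True])
    next
      case False
      then have eB: "e \<in> E - B" using e by blast
      show ?thesis
        using circ.reduced_weight_fund_circuit[OF B eB zB xz(2)]
        by (intro same[OF entries _ xz(4)]) (simp add: basis_orientation_off[OF eB])
    qed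
  next
    case False
    then show ?thesis
      using Oo by (auto simp: orientations_def basis_orientation_def PiE_def extensional_def)
  qed
  then show ?thesis using that[OF B] by blast
qed

lemma basis_orientation_bij: "bij_betw \<beta> (bases M) compatible_set"
proof (rule bij_betw_imageI)
  show "inj_on \<beta> (bases M)"
    by (rule inj_onI) (use basis_subset_if_same_orientation in \<open>metis subset_antisym\<close>)
  show "\<beta> ` bases M = compatible_set"
    using basis_orientation_compatible compatible_orientation_from_basis by blast
qed

text \<open>
  At each \<open>e\<close>, the integer \<open>s = k(e) + y(e)\<close> is \<open>-1\<close>, \<open>0\<close> or \<open>1\<close>, so
  \<open>k(e) y(e) = k(e) s - k(e)\<^sup>2 \<le> 0\<close>. These products sum to \<open>k \<bullet> y = 0\<close>, so all vanish: \<open>k\<close> and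
  \<open>y\<close> have disjoint supports and each is conformal to \<open>\<O>\<close> and to \<open>-\<O>'\<close>.
\<close>

lemma compatible_orientations_congruent_eq:
  assumes O: "\<O> \<in> compatible_set" "\<O>' \<in> compatible_set"
    and k: "real_vec k \<in> K" and y: "real_vec y \<in> R"
    and eq: "\<And>e. \<O> e - \<O>' e = 2 * (k e + y e)"
  shows "\<O> = \<O>'"
proof -
  have Oo: "\<O> \<in> orientations E" "\<O>' \<in> orientations E" using O by (simp_all add: compatible_set_def)
  have cases: "(k e + y e = 0 \<or> k e + y e = \<O> e) \<and>
      (k e + y e \<noteq> 0 \<longrightarrow> \<O>' e = - \<O> e) \<and> (\<O> e = 1 \<or> \<O> e = -1)"
    if "e \<in> E" for e
    using eq[of e] orientation_entry[OF Oo(1) that] orientation_entry[OF Oo(2) that] by auto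
  have square_le: "a * s \<le> a * a" if "s = 0 \<or> s = 1 \<or> s = -1" for a s :: int
  proof -
    have "\<bar>a\<bar> \<le> a * a"
      using mult_left_mono[of 1 "\<bar>a\<bar>" "\<bar>a\<bar>"] by (cases "a = 0") simp_all
    then show ?thesis using that by auto
  qed
  have le: "k e * y e \<le> 0" if "e \<in> E" for e
  proof -
    have "k e * k e + k e * y e = k e * (k e + y e)" by (simp add: algebra_simps)
    moreover have "k e * (k e + y e) \<le> k e * k e"
      by (rule square_le) (use cases[OF that] in auto)
    ultimately show ?thesis by simp
  qed
  have "dot E (real_vec k) (real_vec y) = 0" by (rule circ.orthogonal[OF k y])
  then have "(\<Sum>e\<in>E. - (k e * y e)) = 0"
    unfolding dot_def sum_negf by (simp flip: of_int_mult of_int_sum)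
  then have disj: "k e = 0 \<or> y e = 0" if "e \<in> E" for e
    using sum_nonneg_eq_0_iff[OF circ.finite_E, of "\<lambda>e. - (k e * y e)"] le that by auto
  have "real_vec k e = 0" for e
  proof (rule circ.no_common_conformal_vector[OF _ _ Oo k])
    fix e assume "real_vec k e \<noteq> 0"
    moreover from this have "e \<in> E" using circ.outside[OF k] by blast
    ultimately show "0 < real_vec \<O> e * real_vec k e \<and> real_vec \<O>' e * real_vec k e < 0"
      using cases[of e] disj[of e] by auto
  qed (use O in \<open>simp_all add: compatible_set_def\<close>)
  moreover have "real_vec y e = 0" for e
  proof (rule cocirc.no_common_conformal_vector[OF _ _ Oo y])
    fix e assume "real_vec y e \<noteq> 0"
    moreover from this have "e \<in> E" using cocirc.outside[OF y] by blast
    ultimately show "0 < real_vec \<O> e * real_vec y e \<and> real_vec \<O>' e * real_vec y e < 0"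
      using cases[of e] disj[of e] by auto
  qed (use O in \<open>simp_all add: compatible_set_def\<close>)
  ultimately show ?thesis using eq by (intro ext) simp
qed

lemma incompatible_orientation_reversal:
  assumes "\<O> \<in> orientations E" "\<O> \<notin> compatible_set"
  obtains x where "x \<in> signed_circuits_of E K \<union> signed_circuits_of E R" "compatible \<O> x"
    "dot E (\<lambda>e. w e + ws e) (real_vec \<O>) < dot E (\<lambda>e. w e + ws e) (real_vec (reversal \<O> x))"
proof (cases "sig_compatible (circuits E M) (signed_circuits_of E K) \<sigma> \<O>")
  case True
  then have "\<not> sig_compatible (circuits E (independent_sets E R)) (signed_circuits_of E R) \<sigma>s \<O>"
    using assms by (simp add: compatible_set_def)
  from cocirc.weight_increases_by_reversal[OF this circ.weight_in]
  obtain x where "x \<in> signed_circuits_of E R" "compatible \<O> x"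
    "dot E (\<lambda>e. ws e + w e) (real_vec \<O>) < dot E (\<lambda>e. ws e + w e) (real_vec (reversal \<O> x))"
    by blast
  then show ?thesis using that[of x] by (simp add: add.commute)
next
  case False
  from circ.weight_increases_by_reversal[OF this cocirc.weight_in] show ?thesis using that by blast
qed

end

section \<open>Kernel and row space of a matrix\<close>

definition kernel_space :: "nat \<Rightarrow> 'e set \<Rightarrow> (nat \<Rightarrow> 'e \<Rightarrow> real) \<Rightarrow> ('e \<Rightarrow> real) set" where
  "kernel_space r E A = {k. (\<forall>e. e \<notin> E \<longrightarrow> k e = 0) \<and> (\<forall>i<r. (\<Sum>e\<in>E. A i e * k e) = 0)}"

definition row_space :: "nat \<Rightarrow> 'e set \<Rightarrow> (nat \<Rightarrow> 'e \<Rightarrow> real) \<Rightarrow> ('e \<Rightarrow> real) set" where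
  "row_space r E A = {y. (\<forall>e. e \<notin> E \<longrightarrow> y e = 0) \<and> (\<exists>c. \<forall>e\<in>E. y e = (\<Sum>i<r. c i * A i e))}"

lemma dot_row_combination:
  "dot E k (\<lambda>e. \<Sum>i<r. c i * A i e) = (\<Sum>i<r. c i * (\<Sum>e\<in>E. A i e * k e))"
  unfolding dot_def sum_distrib_left by (subst sum.swap) (simp add: mult_ac)

text \<open>
  That a vector orthogonal to the kernel is a combination of the rows is the statement that a
  functional vanishing on the common kernel of the rows lies in their span.
\<close>

lemma orthogonal_pair_kernel_row:
  fixes A :: "nat \<Rightarrow> 'e \<Rightarrow> real"
  assumes fin: "finite E"
  shows "orthogonal_pair E (kernel_space r E A) (row_space r E A)"
proof
  show "finite E" by (fact fin)
next
  have orth: "dot E k y = 0" if k: "k \<in> kernel_space r E A" and y: "y \<in> row_space r E A" for k y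
  proof -
    obtain c where c: "\<forall>e\<in>E. y e = (\<Sum>i<r. c i * A i e)" using y by (auto simp: row_space_def)
    have "dot E k y = dot E k (\<lambda>e. \<Sum>i<r. c i * A i e)" using c by (simp add: dot_def)
    then show ?thesis using k by (simp add: dot_row_combination kernel_space_def)
  qed
  show "k \<in> kernel_space r E A \<longleftrightarrow>
      (\<forall>e. e \<notin> E \<longrightarrow> k e = 0) \<and> (\<forall>y\<in>row_space r E A. dot E k y = 0)" for k
  proof (intro iffI conjI)
    assume k: "(\<forall>e. e \<notin> E \<longrightarrow> k e = 0) \<and> (\<forall>y\<in>row_space r E A. dot E k y = 0)"
    have "(\<Sum>e\<in>E. A i e * k e) = 0" if i: "i < r" for i
    proof -
      let ?y = "\<lambda>e. if e \<in> E then A i e else 0"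
      have "\<forall>e\<in>E. ?y e = (\<Sum>j<r. (if j = i then 1 else 0) * A j e)"
        using i by (simp add: if_distrib[of "\<lambda>c. c * _"] cong: if_cong)
      then have "?y \<in> row_space r E A" unfolding row_space_def by force
      then have "dot E k ?y = 0" using k by blast
      then show ?thesis by (simp add: dot_def mult.commute cong: sum.cong)
    qed
    then show "k \<in> kernel_space r E A" using k by (simp add: kernel_space_def)
  qed (use orth in \<open>auto simp: kernel_space_def\<close>)
  show "y \<in> row_space r E A \<longleftrightarrow>
      (\<forall>e. e \<notin> E \<longrightarrow> y e = 0) \<and> (\<forall>k\<in>kernel_space r E A. dot E k y = 0)" for y
  proof (intro iffI conjI)
    assume y: "(\<forall>e. e \<notin> E \<longrightarrow> y e = 0) \<and> (\<forall>k\<in>kernel_space r E A. dot E k y = 0)"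
    let ?W = "{v :: 'e \<Rightarrow> real. \<forall>e. e \<notin> E \<longrightarrow> v e = 0}"
    have "\<exists>c. \<forall>v\<in>?W. dot E y v = (\<Sum>i\<in>{..<r}. c i * dot E (A i) v)"
    proof (rule functional_in_span_if_kernel_subset)
      fix u v :: "'e \<Rightarrow> real" and c assume "u \<in> ?W" "v \<in> ?W"
      then show "\<exists>z\<in>?W. (\<forall>i\<in>{..<r}. dot E (A i) z = dot E (A i) u + c * dot E (A i) v) \<and>
          dot E y z = dot E y u + c * dot E y v"
        by (intro bexI[of _ "\<lambda>e. u e + c * v e"]) (simp_all add: dot_linear)
    next
      fix v assume v: "v \<in> ?W" "\<forall>i\<in>{..<r}. dot E (A i) v = 0"
      then have "v \<in> kernel_space r E A" by (simp add: kernel_space_def dot_def)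
      then show "dot E y v = 0" using y by (simp add: dot_commute[of E y])
    qed simp
    then obtain c where c: "\<forall>v\<in>?W. dot E y v = (\<Sum>i<r. c i * dot E (A i) v)" by blast
    have "y e = (\<Sum>i<r. c i * A i e)" if e: "e \<in> E" for e
    proof -
      have "(\<lambda>d. if d = e then 1 else 0) \<in> ?W" using e by auto
      from bspec[OF c this] show ?thesis by (simp add: dot_unit[OF fin e])
    qed
    then show "y \<in> row_space r E A" using y by (auto simp: row_space_def)
  qed (use orth in \<open>auto simp: row_space_def\<close>)
qed

lemma column_matroid_eq:
  fixes A :: "nat \<Rightarrow> 'e \<Rightarrow> real"
  assumes fin: "finite E"
  shows "column_matroid r E A = independent_sets E (kernel_space r E A)"
proof -
  have "(\<forall>c. (\<forall>i<r. (\<Sum>e\<in>S. c e * A i e) = 0) \<longrightarrow> (\<forall>e\<in>S. c e = 0)) \<longleftrightarrow>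
      (\<forall>k\<in>kernel_space r E A. (\<forall>e. e \<notin> S \<longrightarrow> k e = 0) \<longrightarrow> (\<forall>e. k e = 0))"
    (is "?L \<longleftrightarrow> ?R") if S: "S \<subseteq> E" for S
  proof
    assume L: ?L
    show ?R
    proof (intro ballI impI allI)
      fix k e assume k: "k \<in> kernel_space r E A" "\<forall>e. e \<notin> S \<longrightarrow> k e = 0"
      have "(\<Sum>e\<in>S. k e * A i e) = (\<Sum>e\<in>E. A i e * k e)" for i
        using k(2) S fin by (intro sum.mono_neutral_cong_left) auto
      then have "\<forall>i<r. (\<Sum>e\<in>S. k e * A i e) = 0" using k(1) by (simp add: kernel_space_def)
      with L[rule_format, of k] have "\<forall>e\<in>S. k e = 0" by blast
      then show "k e = 0" using k(2) by blast
    qed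
  next
    assume R: ?R
    show ?L
    proof (intro allI impI)
      fix c :: "'e \<Rightarrow> real" assume c: "\<forall>i<r. (\<Sum>e\<in>S. c e * A i e) = 0"
      define k where "k e = (if e \<in> S then c e else 0)" for e
      have "(\<Sum>e\<in>E. A i e * k e) = (\<Sum>e\<in>S. c e * A i e)" for i
        using S fin by (intro sum.mono_neutral_cong_right) (auto simp: k_def)
      then have "k \<in> kernel_space r E A" using c S by (auto simp: kernel_space_def k_def)
      moreover have "\<forall>e. e \<notin> S \<longrightarrow> k e = 0" by (simp add: k_def)
      ultimately have "\<forall>e. k e = 0" by (rule R[THEN bspec, THEN mp])
      then show "\<forall>e\<in>S. c e = 0" by (auto simp: k_def split: if_splits)
    qed
  qed
  then show ?thesis
    unfolding column_matroid_def independent_sets_def by (intro Collect_cong conj_cong refl)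
qed

lemma signed_circuits_eq:
  "finite E \<Longrightarrow> signed_circuits r E A = signed_circuits_of E (kernel_space r E A)"
  by (auto simp: signed_circuits_def signed_circuits_of_def in_kernel_def kernel_space_def
      sign_vectors_def column_matroid_eq)

lemma signed_cocircuits_eq:
  assumes "finite E"
  shows "signed_cocircuits r E A = signed_circuits_of E (row_space r E A)"
proof -
  have "cocircuits E (column_matroid r E A) = circuits E (independent_sets E (row_space r E A))"
    using orthogonal_pair.dual_matroid_eq[OF orthogonal_pair_kernel_row[OF assms]]
    by (simp add: cocircuits_def column_matroid_eq[OF assms])
  then show ?thesis
    by (auto simp: signed_cocircuits_def signed_circuits_of_def in_row_space_def row_space_def
        sign_vectors_def)
qed

section \<open>Reversal classes\<close>

lemma reversal_in_orientations:
  assumes "\<O> \<in> orientations E" "supp x \<subseteq> E"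
  shows "reversal \<O> x \<in> orientations E"
  using assms by (auto simp: orientations_def reversal_def PiE_iff extensional_def)

lemma reversal_step_orientations:
  assumes "reversal_step r E A \<O> \<O>'"
  shows "\<O> \<in> orientations E" "\<O>' \<in> orientations E"
  using assms
  by (auto simp: reversal_step_def signed_circuits_def signed_cocircuits_def circuits_def
      cocircuits_def intro!: reversal_in_orientations)

lemma equiv_reversal: "equiv (orientations E) (reversal_equiv r E A)"
proof (rule equivI)
  show "reversal_equiv r E A \<subseteq> orientations E \<times> orientations E"
    by (auto simp: reversal_equiv_def)
  show "refl_on (orientations E) (reversal_equiv r E A)"
    by (rule refl_onI) (simp add: reversal_equiv_def)
  show "sym (reversal_equiv r E A)"
    by (rule symI) (simp add: reversal_equiv_def equivclp_sym)
  show "trans (reversal_equiv r E A)"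
  proof (rule transI)
    fix \<O>1 \<O>2 \<O>3 assume "(\<O>1, \<O>2) \<in> reversal_equiv r E A" "(\<O>2, \<O>3) \<in> reversal_equiv r E A"
    then show "(\<O>1, \<O>3) \<in> reversal_equiv r E A"
      using equivclp_trans[of "reversal_step r E A" \<O>1 \<O>2 \<O>3] by (simp add: reversal_equiv_def)
  qed
qed

text \<open>
  A reversal along a compatible \<open>x\<close> subtracts \<open>2 x\<close> from the orientation.
\<close>

lemma reversal_equiv_difference:
  assumes fin: "finite E" and equiv: "(\<O>, \<O>') \<in> reversal_equiv r E A"
  obtains k y where "real_vec k \<in> kernel_space r E A" "real_vec y \<in> row_space r E A"
    "\<And>e. \<O> e - \<O>' e = 2 * (k e + y e)"
proof -
  interpret orthogonal_pair E "kernel_space r E A" "row_space r E A"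
    by (rule orthogonal_pair_kernel_row[OF fin])
  interpret dual: orthogonal_pair E "row_space r E A" "kernel_space r E A" by (rule dual)
  let ?P = "\<lambda>\<O> \<O>'. \<exists>k y. real_vec k \<in> kernel_space r E A \<and> real_vec y \<in> row_space r E A \<and>
    (\<forall>e. \<O> e - \<O>' e = 2 * (k e + y e))"
  have refl: "?P \<O> \<O>" for \<O> :: "'a \<Rightarrow> int"
    using zero_in dual.zero_in by (intro exI[of _ "\<lambda>_. 0"]) simp
  have step_diff: "?P \<O> \<O>'" if s: "reversal_step r E A \<O> \<O>'" for \<O> \<O>'
  proof -
    obtain x where x: "x \<in> signed_circuits r E A \<union> signed_cocircuits r E A"
      "compatible \<O> x" "\<O>' = reversal \<O> x" using s by (auto simp: reversal_step_def)
    have diff: "\<O> e - \<O>' e = 2 * x e" for e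
      using x(2,3) by (auto simp: reversal_def compatible_def supp_def)
    from x(1) consider "real_vec x \<in> kernel_space r E A" | "real_vec x \<in> row_space r E A"
      by (auto simp: signed_circuits_eq[OF fin] signed_cocircuits_eq[OF fin] signed_circuits_of_def)
    then show ?thesis
    proof cases
      case 1
      then show ?thesis using diff dual.zero_in by (intro exI[of _ x] exI[of _ "\<lambda>_. 0"]) simp
    next
      case 2
      then show ?thesis using diff zero_in by (intro exI[of _ "\<lambda>_. 0"] exI[of _ x]) simp
    qed
  qed
  have combine: "?P \<O> \<O>''"
    if P: "?P \<O> \<O>'" and diff: "\<And>e. \<O>' e - \<O>'' e = c * (2 * (k' e + y' e))"
      and k': "real_vec k' \<in> kernel_space r E A" and y': "real_vec y' \<in> row_space r E A"
    for \<O> \<O>' \<O>'' :: "'a \<Rightarrow> int" and c k' y'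
  proof -
    obtain k y where k: "real_vec k \<in> kernel_space r E A" "real_vec y \<in> row_space r E A"
      "\<forall>e. \<O> e - \<O>' e = 2 * (k e + y e)" using P by blast
    have "\<O> e - \<O>'' e = 2 * ((k e + c * k' e) + (y e + c * y' e))" for e
      using k(3)[rule_format, of e] diff[of e] by (simp add: algebra_simps)
    moreover have "real_vec (\<lambda>e. k e + c * k' e) \<in> kernel_space r E A"
      using combination_in[OF k(1) k', of "of_int c"] by simp
    moreover have "real_vec (\<lambda>e. y e + c * y' e) \<in> row_space r E A"
      using dual.combination_in[OF k(2) y', of "of_int c"] by simp
    ultimately show ?thesis by (intro exI conjI allI)
  qed
  have "equivclp (reversal_step r E A) \<O> \<O>'" using equiv by (simp add: reversal_equiv_def)
  then have "?P \<O> \<O>'"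
  proof (induction rule: equivclp_induct)
    case base
    show ?case by (rule refl)
  next
    case (step \<O>1 \<O>2)
    from step.hyps(2) show ?case
    proof
      assume "reversal_step r E A \<O>1 \<O>2"
      then obtain k y where k: "real_vec k \<in> kernel_space r E A" "real_vec y \<in> row_space r E A"
        "\<forall>e. \<O>1 e - \<O>2 e = 2 * (k e + y e)" using step_diff by blast
      have "\<O>1 e - \<O>2 e = 1 * (2 * (k e + y e))" for e
        using k(3)[rule_format, of e] by linarith
      then show ?thesis by (rule combine[OF step.IH _ k(1,2)])
    next
      assume "reversal_step r E A \<O>2 \<O>1"
      then obtain k y where k: "real_vec k \<in> kernel_space r E A" "real_vec y \<in> row_space r E A"
        "\<forall>e. \<O>2 e - \<O>1 e = 2 * (k e + y e)" using step_diff by blast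
      have "\<O>1 e - \<O>2 e = -1 * (2 * (k e + y e))" for e
        using k(3)[rule_format, of e] by linarith
      then show ?thesis by (rule combine[OF step.IH _ k(1,2)])
    qed
  qed
  then show ?thesis using that by blast
qed

theorem theorem1p3p1:
  fixes E :: "'e set" and r :: nat and A :: "nat \<Rightarrow> 'e \<Rightarrow> real"
    and \<sigma> \<sigma>s :: "'e set \<Rightarrow> 'e \<Rightarrow> int"
  defines "M \<equiv> column_matroid r E A"
  assumes finite_E: "finite E"
    and tu: "totally_unimodular r E A"
    and rank: "has_rank r E A r"
    and sig: "signature (circuits E M) (signed_circuits r E A) \<sigma>"
    and acyc: "acyclic_signature E (circuits E M) \<sigma>"
    and cosig: "signature (cocircuits E M) (signed_cocircuits r E A) \<sigma>s"
    and coacyc: "acyclic_signature E (cocircuits E M) \<sigma>s"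
  shows "(basis_orientation E M \<sigma> \<sigma>s ` bases M \<subseteq> compatible_orientations r E A \<sigma> \<sigma>s \<and>
          bij_betw (basis_orientation E M \<sigma> \<sigma>s) (bases M) (compatible_orientations r E A \<sigma> \<sigma>s)) \<and>
         bij_betw (reversal_class r E A) (compatible_orientations r E A \<sigma> \<sigma>s)
           (reversal_classes r E A)"
proof -
  let ?K = "kernel_space r E A" and ?R = "row_space r E A"
  let ?X = "compatible_orientations r E A \<sigma> \<sigma>s"
  interpret KR: orthogonal_pair E ?K ?R by (rule orthogonal_pair_kernel_row[OF finite_E])
  interpret RK: orthogonal_pair E ?R ?K by (rule KR.dual)
  have M: "M = independent_sets E ?K" unfolding M_def by (rule column_matroid_eq[OF finite_E])
  have coc: "cocircuits E M = circuits E (independent_sets E ?R)"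
    by (simp add: cocircuits_def M KR.dual_matroid_eq)
  note S = signed_circuits_eq[OF finite_E, of r A] signed_cocircuits_eq[OF finite_E, of r A]
  obtain w where w: "w \<in> ?K"
      "\<And>C. C \<in> circuits E (independent_sets E ?K) \<Longrightarrow> 0 < dot E w (real_vec (\<sigma> C))"
    using KR.acyclic_signature_weight[OF sig[unfolded M S] acyc[unfolded M]] by blast
  obtain ws where ws: "ws \<in> ?R"
      "\<And>C. C \<in> circuits E (independent_sets E ?R) \<Longrightarrow> 0 < dot E ws (real_vec (\<sigma>s C))"
    using RK.acyclic_signature_weight[OF cosig[unfolded coc S] coacyc[unfolded coc]] by blast
  interpret P: weighted_signature_pair E ?K ?R \<sigma> \<sigma>s w ws
    by unfold_locales (use sig[unfolded M S] cosig[unfolded coc S] w ws in blast)+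
  have X: "?X = P.compatible_set"
    by (simp add: compatible_orientations_def P.compatible_set_def S coc flip: M_def) (simp add: M)
  have beta: "bij_betw (basis_orientation E M \<sigma> \<sigma>s) (bases M) ?X"
    unfolding X M by (rule P.basis_orientation_bij)
  let ?pot = "\<lambda>\<O>. dot E (\<lambda>e. w e + ws e) (real_vec \<O>)"
  let ?eq = "reversal_equiv r E A"
  have fin_or: "finite (orientations E)"
    unfolding orientations_def by (rule finite_PiE[OF finite_E]) simp
  have XO: "?X \<subseteq> orientations E" by (auto simp: compatible_orientations_def)
  have "inj_on (reversal_class r E A) ?X"
  proof (rule inj_onI)
    fix \<O> \<O>' assume O: "\<O> \<in> ?X" "\<O>' \<in> ?X" "reversal_class r E A \<O> = reversal_class r E A \<O>'"
    have "(\<O>, \<O>') \<in> ?eq"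
      using O XO eq_equiv_class[OF O(3)[unfolded reversal_class_def] equiv_reversal] by blast
    then obtain k y where "real_vec k \<in> ?K" "real_vec y \<in> ?R" "\<And>e. \<O> e - \<O>' e = 2 * (k e + y e)"
      using reversal_equiv_difference[OF finite_E] by blast
    then show "\<O> = \<O>'" using P.compatible_orientations_congruent_eq O(1,2) unfolding X by blast
  qed
  moreover have "reversal_class r E A ` ?X = reversal_classes r E A"
  proof (intro equalityI subsetI)
    fix Q assume "Q \<in> reversal_class r E A ` ?X"
    then show "Q \<in> reversal_classes r E A"
      using XO by (auto simp: reversal_classes_def reversal_class_def intro: quotientI)
  next
    fix Q assume "Q \<in> reversal_classes r E A"
    then obtain \<O> where O: "\<O> \<in> orientations E" "Q = ?eq `` {\<O>}"
      by (auto simp: reversal_classes_def elim: quotientE)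
    have Q: "Q \<subseteq> orientations E" using O by (auto simp: reversal_equiv_def)
    have "\<O> \<in> Q" using O equiv_class_self[OF equiv_reversal] by blast
    moreover have finQ: "finite Q" using Q fin_or by (rule finite_subset)
    \<comment> \<open>Any orientation of maximal potential in the class is compatible.\<close>
    ultimately have "Max (?pot ` Q) \<in> ?pot ` Q" by (intro Max_in) auto
    then obtain \<O>' where O': "\<O>' \<in> Q" "?pot \<O>' = Max (?pot ` Q)" by force
    have "\<O>' \<in> ?X"
    proof (rule ccontr)
      assume "\<O>' \<notin> ?X"
      then obtain x where x: "x \<in> signed_circuits r E A \<union> signed_cocircuits r E A"
          "compatible \<O>' x" "?pot \<O>' < ?pot (reversal \<O>' x)"
        using P.incompatible_orientation_reversal[of \<O>'] O'(1) Q unfolding X S by blast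
      have step: "reversal_step r E A \<O>' (reversal \<O>' x)"
        using x O'(1) Q by (auto simp: reversal_step_def)
      then have "(\<O>', reversal \<O>' x) \<in> ?eq"
        using reversal_step_orientations[OF step] by (auto simp: reversal_equiv_def)
      then have "reversal \<O>' x \<in> Q"
        using O(2) O'(1) equiv_reversal by (auto simp: equiv_def dest: transD)
      then have "?pot (reversal \<O>' x) \<le> Max (?pot ` Q)" using finQ by (intro Max_ge) auto
      then show False using x(3) O'(2) by simp
    qed
    moreover have "Q = reversal_class r E A \<O>'"
      using O O'(1) equiv_class_eq[OF equiv_reversal] unfolding reversal_class_def by blast
    ultimately show "Q \<in> reversal_class r E A ` ?X" by blast
  qed
  ultimately have "bij_betw (reversal_class r E A) ?X (reversal_classes r E A)"
    by (simp add: bij_betw_def)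
  then show ?thesis using beta by (simp add: bij_betw_def)
qed

end
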